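(* Let $m>0$ and $a\in\mathbb{R}$ be such that $a^2<m^2$. For any $\varepsilon\in(0,m)$ and $r_0\in(0,\infty]$, let $$D^a_{\varepsilon,r_0}=\{(x,y,z)\in\mathbb{R}^3 : m+\sqrt{m^2+\varepsilon-a^2\cos^2\theta}<r<r_0\}.$$ Then there exists $a_0>0$, depending on $\varepsilon$, such that the stationary domain $M^a_{\varepsilon,r_0}:=D^a_{\varepsilon,r_0}\times\mathbb{R}$ of Kerr spacetime $M^a$ has strongly light-convex boundary for each $|a|<a_0$, provided that $r_0$ is large enough.
   Context: $(r,\theta,\varphi)$ are regarded as spherical coordinates on $\mathbb{R}^3$ ($\theta$ the polar angle). In Boyer-Lindquist coordinates $(r,\theta,\varphi,t)$ the Kerr metric is $$ds^2=-\frac{\Delta}{\rho^2}(dt-a\sin^2\theta\,d\varphi)^2+\frac{\sin^2\theta}{\rho^2}\big((r^2+a^2)d\varphi-a\,dt\big)^2+\frac{\rho^2}{\Delta}dr^2+\rho^2d\theta^2,$$ $\Delta=r^2-2mr+a^2$, $\rho^2=r^2+a^2\cos^2\theta$. Here $M^a$ is its stationary region $\{r>m+\sqrt{m^2-a^2\cos^2\theta}\}\times\mathbb{R}$, which is standard stationary with respect to the Killing field $\partial_t$. For a domain $D$ with $C^2$ boundary in the slice $S$ of a standard stationary spacetime $(S\times\mathbb{R},g_L)$, the domain $D\times\mathbb{R}$ has strongly light-convex boundary if, for a $C^2$ function $\phi$ with $\phi=0$ exactly on $\partial D$, $\phi>0$ on $D$, $\mathrm d\phi\ne0$ on $\partial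 D$, and $\Phi(x,t)=\phi(x)$, one has $H^{g_L}_\Phi(v,v)<0$ for every lightlike $v$ tangent to $\partial D\times\mathbb{R}$, where $H^{g_L}_\Phi$ is the Hessian for the Levi-Civita connection of $g_L$.
   Formalization: The hypothesis ε < 3m² is added (automatic from ε < m if m ≥ 1/3); for ε ≥ 3m² the claim fails at a = 0, since the inner boundary sphere r = m+√(m²+ε) then has r ≥ 3m and its Hessian on lightlike tangent vectors is not negative (e.g. m = 1/10, ε = 9/100). *)

theory Defs
  imports "HOL-Analysis.Analysis"
begin

section \<open>Hessian of a pseudo-Riemannian metric on an open subset of a Euclidean space\<close>

text \<open>The argument order is: point, tangent vector, tangent vector.\<close>

type_synonym 'a metric = "'a \<Rightarrow> 'a \<Rightarrow> 'a \<Rightarrow> real"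

abbreviation dir_deriv :: "('a::euclidean_space \<Rightarrow> real) \<Rightarrow> 'a \<Rightarrow> 'a \<Rightarrow> real" where
  "dir_deriv f p v \<equiv> frechet_derivative f (at p) v"

text \<open>The Levi-Civita derivative at \<open>p\<close> of the constant vector field \<open>v\<close> in the direction \<open>u\<close>,
  i.e. the vector with components \<open>\<Gamma>\<^sup>k\<^sub>i\<^sub>j u\<^sup>i v\<^sup>j\<close>. It is determined by the Koszul formula
  (the Lie brackets of constant fields vanish), uniquely where the metric is nondegenerate.\<close>

definition christoffel :: "'a::euclidean_space metric \<Rightarrow> 'a \<Rightarrow> 'a \<Rightarrow> 'a \<Rightarrow> 'a" where
  "christoffel g p u v = (THE y. \<forall>w.
     g p y w = (dir_deriv (\<lambda>q. g q v w) p u + dir_deriv (\<lambda>q. g q u w) p v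
                - dir_deriv (\<lambda>q. g q u v) p w) / 2)"

definition hessian :: "'a::euclidean_space metric \<Rightarrow> ('a \<Rightarrow> real) \<Rightarrow> 'a \<Rightarrow> 'a \<Rightarrow> 'a \<Rightarrow> real" where
  "hessian g F p u v =
     dir_deriv (\<lambda>q. dir_deriv F q v) p u - dir_deriv F p (christoffel g p u v)"

definition C1_on :: "'a::euclidean_space set \<Rightarrow> ('a \<Rightarrow> real) \<Rightarrow> bool" where
  "C1_on S f \<longleftrightarrow> (\<forall>x\<in>S. f differentiable (at x)) \<and> (\<forall>v. continuous_on S (\<lambda>x. dir_deriv f x v))"

definition C2_on :: "'a::euclidean_space set \<Rightarrow> ('a \<Rightarrow> real) \<Rightarrow> bool" where
  "C2_on S f \<longleftrightarrow> (\<forall>x\<in>S. f differentiable (at x)) \<and> (\<forall>v. C1_on S (\<lambda>x. dir_deriv f x v))"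

section \<open>Strong light-convexity\<close>

text \<open>\<open>S\<close> is the slice (an open set), \<open>g\<close> the metric of the stationary spacetime \<open>S \<times> \<real>\<close>, and \<open>D\<close>
  a domain in \<open>S\<close>. The boundary of \<open>D\<close> is taken in \<open>S\<close>. Since \<open>\<phi>\<close> is defined on all of
  \<open>S\<close> and \<open>\<partial>D\<close> is a regular level set of it, with \<open>D\<close> on the positive side, the
  condition includes that \<open>\<partial>D\<close> is of class \<open>C\<^sup>2\<close>; the tangent space of \<open>\<partial>D \<times> \<real>\<close> is the
  kernel of the differential of \<open>\<Phi>(x,t) = \<phi>(x)\<close>.\<close>

definition strongly_light_convex_boundary ::
  "'a::euclidean_space set \<Rightarrow> ('a \<times> real) metric \<Rightarrow> 'a set \<Rightarrow> bool" where
  "strongly_light_convex_boundary S g D \<longleftrightarrow>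
     open D \<and> connected D \<and> D \<noteq> {} \<and> D \<subseteq> S \<and>
     (\<exists>\<phi>. C2_on S \<phi> \<and>
        {x \<in> S. \<phi> x = 0} = S \<inter> frontier D \<and>
        (\<forall>x\<in>D. \<phi> x > 0) \<and>
        (\<forall>x\<in>S \<inter> frontier D. \<exists>v. dir_deriv \<phi> x v \<noteq> 0) \<and>
        (\<forall>x\<in>S \<inter> frontier D. \<forall>t v.
           v \<noteq> 0 \<and> g (x, t) v v = 0 \<and> dir_deriv (\<lambda>p. \<phi> (fst p)) (x, t) v = 0
           \<longrightarrow> hessian g (\<lambda>p. \<phi> (fst p)) (x, t) v v < 0))"

section \<open>The Kerr metric\<close>

definition cos_polar :: "real^3 \<Rightarrow> real" where
  "cos_polar x = x $ 3 / norm x"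

definition kerr_Delta :: "real \<Rightarrow> real \<Rightarrow> real \<Rightarrow> real" where
  "kerr_Delta m a r = r\<^sup>2 - 2 * m * r + a\<^sup>2"

text \<open>The polarised Boyer-Lindquist form of the metric, in the coordinates \<open>(r, \<theta>, \<phi>, t)\<close>.\<close>

definition kerr_BL :: "real \<Rightarrow> real \<Rightarrow> (real \<times> real \<times> real \<times> real) metric" where
  "kerr_BL m a = (\<lambda>(r, \<theta>, \<phi>, t) (dr, d\<theta>, d\<phi>, dt) (dr', d\<theta>', d\<phi>', dt').
     let \<Delta> = kerr_Delta m a r; \<rho>2 = r\<^sup>2 + a\<^sup>2 * (cos \<theta>)\<^sup>2 in
       - \<Delta> / \<rho>2 * (dt - a * (sin \<theta>)\<^sup>2 * d\<phi>) * (dt' - a * (sin \<theta>)\<^sup>2 * d\<phi>')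
       + (sin \<theta>)\<^sup>2 / \<rho>2 * ((r\<^sup>2 + a\<^sup>2) * d\<phi> - a * dt) * ((r\<^sup>2 + a\<^sup>2) * d\<phi>' - a * dt')
       + \<rho>2 / \<Delta> * dr * dr' + \<rho>2 * d\<theta> * d\<theta>')"

definition spherical :: "real \<times> real \<times> real \<times> real \<Rightarrow> (real^3) \<times> real" where
  "spherical = (\<lambda>(r, \<theta>, \<phi>, t).
     ((r * sin \<theta> * cos \<phi>) *\<^sub>R axis 1 1 + (r * sin \<theta> * sin \<phi>) *\<^sub>R axis 2 1
      + (r * cos \<theta>) *\<^sub>R axis 3 1, t))"

text \<open>The same metric on (an open subset of) \<open>\<real>\<^sup>3 \<times> \<real>\<close>, where \<open>r = |x|\<close>; this covers the
  rotation axis, on which the Boyer-Lindquist coordinates degenerate. Expanding the squares gives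
  \[ -dt^2 + \frac{2mr}{\rho^2}(dt - a\eta)^2 + a^2\eta^2 + \frac{\rho^2}{\Delta}dr^2
     + \rho^2(d\theta^2 + \sin^2\theta\,d\varphi^2), \]
  where \<open>\<eta> = sin\<^sup>2\<theta> d\<phi> = (x\<^sub>1 dx\<^sub>2 - x\<^sub>2 dx\<^sub>1)/r\<^sup>2\<close> and
  \<open>d\<theta>\<^sup>2 + sin\<^sup>2\<theta> d\<phi>\<^sup>2 = (|dx|\<^sup>2 - dr\<^sup>2)/r\<^sup>2\<close> are smooth away from the origin. Lemma
  \<open>kerr_metric_pullback\<close> identifies the two forms.\<close>

definition kerr_metric :: "real \<Rightarrow> real \<Rightarrow> ((real^3) \<times> real) metric" where
  "kerr_metric m a = (\<lambda>(x, t) (v, dt) (w, dt').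
     let r = norm x; \<rho>2 = r\<^sup>2 + a\<^sup>2 * (cos_polar x)\<^sup>2;
         dr = (\<lambda>u. x \<bullet> u / r); \<eta> = (\<lambda>u. (x $ 1 * u $ 2 - x $ 2 * u $ 1) / r\<^sup>2)
     in - dt * dt' + 2 * m * r / \<rho>2 * (dt - a * \<eta> v) * (dt' - a * \<eta> w)
        + a\<^sup>2 * \<eta> v * \<eta> w + \<rho>2 / kerr_Delta m a r * dr v * dr w
        + \<rho>2 * (v \<bullet> w - dr v * dr w) / r\<^sup>2)"

definition kerr_slice :: "real \<Rightarrow> real \<Rightarrow> (real^3) set" where
  "kerr_slice m a = {x. norm x > m + sqrt (m\<^sup>2 - a\<^sup>2 * (cos_polar x)\<^sup>2)}"

text \<open>For \<open>a = 0\<close> the inner boundary of the following domain is the Schwarzschild sphere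
  \<open>r = m + sqrt (m\<^sup>2 + \<epsilon>)\<close>. It lies strictly inside the photon sphere \<open>r = 3m\<close>, and is then
  strongly light-convex as seen from outside, exactly when \<open>\<epsilon> < 3m\<^sup>2\<close>.\<close>

definition kerr_domain :: "real \<Rightarrow> real \<Rightarrow> real \<Rightarrow> ereal \<Rightarrow> (real^3) set" where
  "kerr_domain m a \<epsilon> r0 =
     {x. m + sqrt (m\<^sup>2 + \<epsilon> - a\<^sup>2 * (cos_polar x)\<^sup>2) < norm x \<and> ereal (norm x) < r0}"

lemma spherical_has_derivative:
  "(spherical has_derivative (\<lambda>(dr, d\<theta>, d\<phi>, dt).
     ((dr * sin \<theta> * cos \<phi> + r * cos \<theta> * d\<theta> * cos \<phi> - r * sin \<theta> * sin \<phi> * d\<phi>) *\<^sub>R axis 1 1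
      + (dr * sin \<theta> * sin \<phi> + r * cos \<theta> * d\<theta> * sin \<phi> + r * sin \<theta> * cos \<phi> * d\<phi>) *\<^sub>R axis 2 1
      + (dr * cos \<theta> - r * sin \<theta> * d\<theta>) *\<^sub>R axis 3 1, dt))) (at (r, \<theta>, \<phi>, t))"
  unfolding spherical_def case_prod_unfold
  by (auto intro!: derivative_eq_intros ext simp: algebra_simps)

lemma kerr_metric_pullback:
  fixes r \<theta> \<phi> t :: real
  assumes "r > 0"
  defines "c \<equiv> (r, \<theta>, \<phi>, t)"
  shows "kerr_metric m a (spherical c)
           (frechet_derivative spherical (at c) u) (frechet_derivative spherical (at c) w)
         = kerr_BL m a c u w"
proof -
  obtain ur u\<theta> u\<phi> ut wr w\<theta> w\<phi> wt where u: "u = (ur, u\<theta>, u\<phi>, ut)" and w: "w = (wr, w\<theta>, w\<phi>, wt)"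
    by (metis prod_cases4)
  have D: "frechet_derivative spherical (at c) = (\<lambda>(dr, d\<theta>, d\<phi>, dt).
     ((dr * sin \<theta> * cos \<phi> + r * cos \<theta> * d\<theta> * cos \<phi> - r * sin \<theta> * sin \<phi> * d\<phi>) *\<^sub>R axis 1 1
      + (dr * sin \<theta> * sin \<phi> + r * cos \<theta> * d\<theta> * sin \<phi> + r * sin \<theta> * cos \<phi> * d\<phi>) *\<^sub>R axis 2 1
      + (dr * cos \<theta> - r * sin \<theta> * d\<theta>) *\<^sub>R axis 3 1, dt))"
    unfolding c_def using frechet_derivative_at[OF spherical_has_derivative] by metis
  define x where "x = fst (spherical c)"
  have xc: "x $ 1 = r * sin \<theta> * cos \<phi>" "x $ 2 = r * sin \<theta> * sin \<phi>" "x $ 3 = r * cos \<theta>"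
    by (simp_all add: x_def spherical_def c_def axis_def)
  have inner3: "p \<bullet> q = p $ 1 * q $ 1 + p $ 2 * q $ 2 + p $ 3 * q $ 3" for p q :: "real^3"
    by (simp add: inner_vec_def sum_3)
  have "norm x ^ 2 = r ^ 2"
    unfolding power2_norm_eq_inner inner3 xc
    using sin_cos_squared_add[of \<theta>] sin_cos_squared_add[of \<phi>] by algebra
  then have nx: "norm x = r"
    using assms(1) by (simp add: power2_eq_iff_nonneg)
  have sp: "spherical c = (x, t)"
    by (simp add: x_def spherical_def c_def)
  have cp: "cos_polar x = cos \<theta>"
    using assms(1) by (simp add: cos_polar_def nx xc)
  define U where "U = fst (frechet_derivative spherical (at c) u)"
  define W where "W = fst (frechet_derivative spherical (at c) w)"
  have Uc: "U $ 1 = ur * sin \<theta> * cos \<phi> + r * cos \<theta> * u\<theta> * cos \<phi> - r * sin \<theta> * sin \<phi> * u\<phi>"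
      "U $ 2 = ur * sin \<theta> * sin \<phi> + r * cos \<theta> * u\<theta> * sin \<phi> + r * sin \<theta> * cos \<phi> * u\<phi>"
      "U $ 3 = ur * cos \<theta> - r * sin \<theta> * u\<theta>"
    and Wc: "W $ 1 = wr * sin \<theta> * cos \<phi> + r * cos \<theta> * w\<theta> * cos \<phi> - r * sin \<theta> * sin \<phi> * w\<phi>"
      "W $ 2 = wr * sin \<theta> * sin \<phi> + r * cos \<theta> * w\<theta> * sin \<phi> + r * sin \<theta> * cos \<phi> * w\<phi>"
      "W $ 3 = wr * cos \<theta> - r * sin \<theta> * w\<theta>"
    by (simp_all add: U_def W_def D u w axis_def)
  have Du: "frechet_derivative spherical (at c) u = (U, ut)"
    and Dw: "frechet_derivative spherical (at c) w = (W, wt)"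
    by (simp_all add: U_def W_def D u w)
  note trig = sin_cos_squared_add[of \<theta>] sin_cos_squared_add[of \<phi>]
  have "x \<bullet> U = r * ur" "x \<bullet> W = r * wr"
    unfolding inner3 xc Uc Wc using trig by algebra+
  then have dr: "x \<bullet> U / r = ur" "x \<bullet> W / r = wr"
    using assms(1) by simp_all
  have "x $ 1 * U $ 2 - x $ 2 * U $ 1 = r\<^sup>2 * ((sin \<theta>)\<^sup>2 * u\<phi>)"
       "x $ 1 * W $ 2 - x $ 2 * W $ 1 = r\<^sup>2 * ((sin \<theta>)\<^sup>2 * w\<phi>)"
    unfolding xc Uc Wc using trig by algebra+
  then have eta: "(x $ 1 * U $ 2 - x $ 2 * U $ 1) / r\<^sup>2 = (sin \<theta>)\<^sup>2 * u\<phi>"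
       "(x $ 1 * W $ 2 - x $ 2 * W $ 1) / r\<^sup>2 = (sin \<theta>)\<^sup>2 * w\<phi>"
    using assms(1) by simp_all
  have "U \<bullet> W = ur * wr + r\<^sup>2 * (u\<theta> * w\<theta> + (sin \<theta>)\<^sup>2 * u\<phi> * w\<phi>)"
    unfolding inner3 Uc Wc using trig by algebra
  then have ang: "(U \<bullet> W - ur * wr) / r\<^sup>2 = u\<theta> * w\<theta> + (sin \<theta>)\<^sup>2 * u\<phi> * w\<phi>"
    using assms(1) by simp
  define \<rho>2 where "\<rho>2 = r\<^sup>2 + a\<^sup>2 * (cos \<theta>)\<^sup>2"
  define S where "S = (sin \<theta>)\<^sup>2"
  define \<Delta> where "\<Delta> = kerr_Delta m a r"
  have rho: "\<rho>2 > 0"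
    unfolding \<rho>2_def using assms(1) by (intro add_pos_nonneg) auto
  have S: "\<rho>2 = r\<^sup>2 + a\<^sup>2 * (1 - S)"
    by (simp add: \<rho>2_def S_def cos_squared_eq)
  have "kerr_metric m a (spherical c) (frechet_derivative spherical (at c) u)
          (frechet_derivative spherical (at c) w)
      = - ut * wt + 2 * m * r / \<rho>2 * (ut - a * (S * u\<phi>)) * (wt - a * (S * w\<phi>))
        + a\<^sup>2 * (S * u\<phi>) * (S * w\<phi>) + \<rho>2 / \<Delta> * ur * wr
        + \<rho>2 * (u\<theta> * w\<theta> + S * u\<phi> * w\<phi>)"
    unfolding sp Du Dw kerr_metric_def prod.case Let_def nx cp dr eta
      \<rho>2_def[symmetric] S_def[symmetric] \<Delta>_def[symmetric]
    using arg_cong[OF ang, of "(*) \<rho>2"] by (simp add: S_def)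
  also have "\<dots> = - \<Delta> / \<rho>2 * (ut - a * S * u\<phi>) * (wt - a * S * w\<phi>)
       + S / \<rho>2 * ((r\<^sup>2 + a\<^sup>2) * u\<phi> - a * ut) * ((r\<^sup>2 + a\<^sup>2) * w\<phi> - a * wt)
       + \<rho>2 / \<Delta> * ur * wr + \<rho>2 * u\<theta> * w\<theta>"
  proof -
    have divide_through: "P + K / \<rho>2 * X * Y = - L / \<rho>2 * X' * Y' + N / \<rho>2 * Z * W"
      if "\<rho>2 * P + K * X * Y = - L * X' * Y' + N * Z * W" for P K X Y L X' Y' N Z W :: real
      using that rho by (simp add: field_simps)
    have "\<rho>2 * (- ut * wt + a\<^sup>2 * (S * u\<phi>) * (S * w\<phi>) + \<rho>2 * (S * u\<phi> * w\<phi>))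
          + 2 * m * r * (ut - a * (S * u\<phi>)) * (wt - a * (S * w\<phi>))
        = - \<Delta> * (ut - a * S * u\<phi>) * (wt - a * S * w\<phi>)
          + S * ((r\<^sup>2 + a\<^sup>2) * u\<phi> - a * ut) * ((r\<^sup>2 + a\<^sup>2) * w\<phi> - a * wt)"
      unfolding S \<Delta>_def kerr_Delta_def by algebra
    then have "- ut * wt + a\<^sup>2 * (S * u\<phi>) * (S * w\<phi>) + \<rho>2 * (S * u\<phi> * w\<phi>)
          + 2 * m * r / \<rho>2 * (ut - a * (S * u\<phi>)) * (wt - a * (S * w\<phi>))
        = - \<Delta> / \<rho>2 * (ut - a * S * u\<phi>) * (wt - a * S * w\<phi>)
          + S / \<rho>2 * ((r\<^sup>2 + a\<^sup>2) * u\<phi> - a * ut) * ((r\<^sup>2 + a\<^sup>2) * w\<phi> - a * wt)"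
      by (rule divide_through)
    then show ?thesis by (simp add: algebra_simps)
  qed
  also have "\<dots> = kerr_BL m a c u w"
    by (simp add: kerr_BL_def c_def u w Let_def \<rho>2_def S_def \<Delta>_def)
  finally show ?thesis .
qed

text \<open>The stationary region is standard stationary: \<open>\<partial>\<^sub>t\<close> is timelike and the slices are
  spacelike. In particular the metric is nondegenerate there.\<close>

lemma kerr_standard_stationary:
  assumes "m > 0" "a\<^sup>2 < m\<^sup>2" "x \<in> kerr_slice m a"
  shows "kerr_metric m a (x, t) (0, 1) (0, 1) < 0"
    and "v \<noteq> 0 \<Longrightarrow> kerr_metric m a (x, t) (v, 0) (v, 0) > 0"
proof -
  define r where "r = norm x"
  define c where "c = cos_polar x"
  define \<rho>2 where "\<rho>2 = r\<^sup>2 + a\<^sup>2 * c\<^sup>2"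
  define \<Delta> where "\<Delta> = kerr_Delta m a r"
  have r: "r > m + sqrt (m\<^sup>2 - a\<^sup>2 * c\<^sup>2)"
    using assms(3) by (simp add: kerr_slice_def r_def c_def)
  have "\<bar>x $ 3\<bar> \<le> norm x"
    by (rule component_le_norm_cart)
  then have "\<bar>c\<bar> \<le> 1"
    by (auto simp: c_def cos_polar_def divide_le_eq_1)
  then have c: "c\<^sup>2 \<le> 1"
    by (simp add: abs_square_le_1)
  then have ac: "a\<^sup>2 * c\<^sup>2 \<le> a\<^sup>2"
    by (simp add: mult_left_le)
  have s0: "sqrt (m\<^sup>2 - a\<^sup>2 * c\<^sup>2) \<ge> 0"
    using ac assms(2) by simp
  have r0: "r > 0" "r - m > sqrt (m\<^sup>2 - a\<^sup>2 * c\<^sup>2)"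
    using r s0 assms(1) by linarith+
  have "(r - m)\<^sup>2 > (sqrt (m\<^sup>2 - a\<^sup>2 * c\<^sup>2))\<^sup>2"
    using r0(2) s0 by (intro power_strict_mono) auto
  then have "(r - m)\<^sup>2 > m\<^sup>2 - a\<^sup>2 * c\<^sup>2"
    using ac assms(2) by simp
  then have erg: "\<rho>2 > 2 * m * r"
    by (simp add: \<rho>2_def power2_eq_square algebra_simps)
  then have D: "\<Delta> > 0"
    using ac by (simp add: \<Delta>_def kerr_Delta_def \<rho>2_def)
  have mr: "2 * m * r > 0"
    using assms(1) r0 by simp
  then have rho: "\<rho>2 > 0"
    using erg by linarith
  show "kerr_metric m a (x, t) (0, 1) (0, 1) < 0"
    using erg rho
    by (simp add: kerr_metric_def Let_def r_def[symmetric] c_def[symmetric] \<rho>2_def[symmetric]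
        divide_less_eq_1_pos)
  assume v: "v \<noteq> 0"
  define e where "e = (x $ 1 * v $ 2 - x $ 2 * v $ 1) / r\<^sup>2"
  define d where "d = x \<bullet> v / r"
  have eq: "kerr_metric m a (x, t) (v, 0) (v, 0)
      = (2 * m * r / \<rho>2 * (a * e)\<^sup>2 + (a * e)\<^sup>2) + (\<rho>2 / \<Delta> * d\<^sup>2 + \<rho>2 / r\<^sup>2 * (v \<bullet> v - d\<^sup>2))"
    unfolding kerr_metric_def prod.case Let_def r_def[symmetric] c_def[symmetric]
      \<rho>2_def[symmetric] e_def[symmetric] d_def[symmetric] \<Delta>_def[symmetric]
    by (simp add: power2_eq_square)
  have "(x \<bullet> v)\<^sup>2 \<le> r\<^sup>2 * (v \<bullet> v)"
    using Cauchy_Schwarz_ineq[of x v] by (simp add: r_def power2_norm_eq_inner)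
  then have dv: "d\<^sup>2 \<le> v \<bullet> v"
    using r0 by (simp add: d_def power_divide divide_le_eq mult.commute)
  have "\<rho>2 / \<Delta> * d\<^sup>2 + \<rho>2 / r\<^sup>2 * (v \<bullet> v - d\<^sup>2) > 0"
  proof (cases "d = 0")
    case True
    then show ?thesis using v rho r0 by simp
  next
    case False
    then show ?thesis using rho D r0 dv by (intro add_pos_nonneg) auto
  qed
  moreover have "2 * m * r / \<rho>2 * (a * e)\<^sup>2 + (a * e)\<^sup>2 \<ge> 0"
    using mr rho by (intro add_nonneg_nonneg mult_nonneg_nonneg) auto
  ultimately show "kerr_metric m a (x, t) (v, 0) (v, 0) > 0"
    unfolding eq by linarith
qed

end

theory Submission
  imports Defs
begin

text \<open>
  The boundary of the domain consists of the surface \<open>f = 0\<close>, where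
  \<open>f = r\<^sup>2 + a\<^sup>2 cos\<^sup>2\<theta> - 2mr - \<epsilon>\<close>, and, if the outer radius \<open>r0\<close> is finite, of the sphere
  \<open>h = 0\<close>, where \<open>h = r0\<^sup>2 - r\<^sup>2\<close>. The function \<open>\<phi> = f h\<close> (or \<open>f\<close>, if \<open>r0 = \<infinity>\<close>) vanishes exactly on
  the boundary and is positive inside. On vectors tangent to one of the two components, its Hessian
  is a positive multiple of that of the factor which vanishes there (\<open>hessian_mult_zero\<close>), so that
  the components can be treated separately. This also needs that they are disjoint: \<open>f \<le> 0\<close> implies
  \<open>r < 3m\<close> because \<open>\<epsilon> < 3m\<^sup>2\<close> (\<open>kerr_level_nonpos_bound\<close>), while \<open>r0 > 12m\<close>.

  Christoffel symbols are avoided. If the vector \<open>N\<close> is the gradient of \<open>F\<close> at a point, extended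
  as a constant field, then the Koszul formula gives
  \<open>Hess F(v,v) = D\<^sup>2F(v,v) - D\<^sub>v(g(v,N)) + D\<^sub>N(g(v,v))/2\<close> there (\<open>hessian_eq_gradient\<close>). For the Kerr
  metric in Cartesian coordinates the right-hand side is explicit.

  On the outer sphere the gradient is radial, and for a tangent vector with spatial part \<open>u\<close> the
  Hessian of \<open>h\<close> is a negative multiple of \<open>2|u|\<^sup>2 + r A\<^sub>r (dt - a \<eta>)\<^sup>2\<close> with \<open>A = 2mr/\<rho>\<^sup>2\<close>. Along
  lightlike vectors \<open>(dt - a \<eta>)\<^sup>2\<close> is at most \<open>3|u|\<^sup>2\<close>, and \<open>r A\<^sub>r\<close> is of order \<open>-m/r\<close>, so the bracket
  is positive for \<open>r \<ge> 12m\<close> (\<open>kerr_hessian_sphere_neg\<close>), for every admissible \<open>a\<close>.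

  On the inner boundary the case \<open>a = 0\<close> is computed: on tangent lightlike vectors the Hessian of
  \<open>f\<close> is a positive multiple of \<open>(1 - 3m/r) dt\<^sup>2\<close>, hence negative inside the photon sphere \<open>r = 3m\<close>
  (\<open>kerr_level_hess_schwarzschild\<close>). Since the explicit Hessian is continuous in \<open>a\<close>, the point and
  the vector jointly, compactness of the set of boundary points and of unit vectors extends the
  sign to all small \<open>|a|\<close> (\<open>kerr_level_hess_neg\<close>).
\<close>

section \<open>Derivatives and Hessians\<close>

lemma dir_deriv_eq:
  assumes "(f has_derivative f') (at p)"
  shows "dir_deriv f p v = f' v"
  using frechet_derivative_at[OF assms] by simp

lemma dir_deriv_linear:
  assumes "f differentiable (at p)"
  shows "linear (frechet_derivative f (at p))"
  using assms frechet_derivative_works has_derivative_linear by blast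

lemma dir_deriv_add:
  assumes "f differentiable (at p)" "g differentiable (at p)"
  shows "dir_deriv (\<lambda>q. f q + g q) p v = dir_deriv f p v + dir_deriv g p v"
  by (rule dir_deriv_eq)
     (use assms in \<open>auto intro!: derivative_eq_intros simp: frechet_derivative_works\<close>)

lemma dir_deriv_scale:
  assumes "f differentiable (at p)"
  shows "dir_deriv (\<lambda>q. c * f q) p v = c * dir_deriv f p v"
  by (rule dir_deriv_eq)
     (use assms in \<open>auto intro!: derivative_eq_intros simp: frechet_derivative_works\<close>)

lemma dir_deriv_mult:
  assumes "f differentiable (at p)" "g differentiable (at p)"
  shows "dir_deriv (\<lambda>q. f q * g q) p v = f p * dir_deriv g p v + dir_deriv f p v * g p"
  by (rule dir_deriv_eq)
     (use assms in \<open>auto intro!: derivative_eq_intros simp: frechet_derivative_works\<close>)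

lemma dir_deriv_cong_open:
  assumes "open S" "p \<in> S" "\<And>q. q \<in> S \<Longrightarrow> f q = g q"
  shows "dir_deriv f p v = dir_deriv g p v"
proof -
  have "(f has_derivative D) (at p) \<longleftrightarrow> (g has_derivative D) (at p)" for D
    using assms has_derivative_transform_within_open[of _ D p UNIV S] by metis
  then show ?thesis by (simp add: frechet_derivative_def)
qed

text \<open>A nondegenerate symmetric bilinear form on a finite-dimensional space represents every
  linear functional.\<close>

lemma nondegenerate_represents:
  fixes B :: "'a::euclidean_space \<Rightarrow> 'a \<Rightarrow> real"
  assumes B: "bilinear B" and nondeg: "\<And>y. (\<And>w. B y w = 0) \<Longrightarrow> y = 0" and l: "linear l"
  shows "\<exists>!y. \<forall>w. B y w = l w"
proof -
  define T where "T y = (\<Sum>b\<in>Basis. B y b *\<^sub>R b)" for y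
  have lin1: "linear (\<lambda>y. B y w)" and lin2: "linear (B y)" for y w
    using B by (auto simp: bilinear_def)
  have expand: "k w = (\<Sum>b\<in>Basis. (w \<bullet> b) * k b)" if "linear k" for k :: "'a \<Rightarrow> real" and w
  proof -
    have "k w = k (\<Sum>b\<in>Basis. (w \<bullet> b) *\<^sub>R b)" by (simp add: euclidean_representation)
    also have "\<dots> = (\<Sum>b\<in>Basis. (w \<bullet> b) * k b)"
      by (simp add: linear_sum[OF that] linear_cmul[OF that])
    finally show ?thesis .
  qed
  have T: "linear T"
    unfolding T_def
    by (rule linearI)
       (simp_all add: linear_add[OF lin1] linear_cmul[OF lin1] algebra_simps sum.distrib scaleR_sum_right)
  have Tb: "T y \<bullet> b = B y b" if "b \<in> Basis" for y b
    using that by (simp add: T_def)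
  have "inj T"
    unfolding linear_injective_0[OF T]
  proof (intro allI impI)
    fix y assume "T y = 0"
    then have "B y b = 0" if "b \<in> Basis" for b
      using Tb[OF that, of y] by simp
    then have "B y w = 0" for w
      by (subst expand[OF lin2]) simp
    then show "y = 0" by (rule nondeg)
  qed
  with T have "surj T" by (rule linear_injective_imp_surjective) simp
  then obtain y where y: "T y = (\<Sum>b\<in>Basis. l b *\<^sub>R b)" by (metis surjD)
  have "B y b = l b" if "b \<in> Basis" for b
    using Tb[OF that, of y] that by (simp add: y)
  then have ex: "\<forall>w. B y w = l w"
    by (intro allI, subst expand[OF lin2], subst expand[OF l]) simp
  show ?thesis
  proof (rule ex1I[of _ y], fact ex)
    fix z assume z: "\<forall>w. B z w = l w"
    have "B (z - y) w = 0" for w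
      using z ex linear_diff[OF lin1[of w]] by simp
    then show "z = y" using nondeg[of "z - y"] by simp
  qed
qed

text \<open>The derivative of \<open>F\<close> along the Christoffel vector is the pairing of that vector with the
  gradient \<open>N\<close>, which the Koszul formula evaluates; \<open>N\<close> enters as a constant vector field.\<close>

lemma hessian_eq_gradient:
  fixes g :: "'a::euclidean_space metric"
  assumes bil: "\<And>q. bilinear (g q)" and sym: "\<And>q v w. g q v w = g q w v"
    and nondeg: "\<And>y. (\<And>w. g p y w = 0) \<Longrightarrow> y = 0"
    and diff: "\<And>v w. (\<lambda>q. g q v w) differentiable (at p)"
    and grad: "\<And>w. dir_deriv F p w = g p N w"
  shows "hessian g F p v v = dir_deriv (\<lambda>q. dir_deriv F q v) p v
           - dir_deriv (\<lambda>q. g q v N) p v + dir_deriv (\<lambda>q. g q v v) p N / 2"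
proof -
  define l where "l w = (dir_deriv (\<lambda>q. g q v w) p v + dir_deriv (\<lambda>q. g q v w) p v
                - dir_deriv (\<lambda>q. g q v v) p w) / 2" for w
  have g: "g q u (x + y) = g q u x + g q u y" "g q u (c *\<^sub>R x) = c * g q u x" for q u x y c
    using bil[of q] by (simp_all add: bilinear_radd bilinear_rmul)
  have lin: "linear (frechet_derivative (\<lambda>q. g q v v) (at p))"
    using diff by (rule dir_deriv_linear)
  have l: "linear l"
    by (rule linearI)
       (simp_all add: l_def g dir_deriv_add[OF diff diff] dir_deriv_scale[OF diff]
         linear_add[OF lin] linear_cmul[OF lin] field_simps)
  have "\<exists>!y. \<forall>w. g p y w = l w"
    using bil nondeg l by (rule nondegenerate_represents)
  then have "\<forall>w. g p (christoffel g p v v) w = l w"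
    unfolding christoffel_def l_def by (rule theI')
  then have "dir_deriv F p (christoffel g p v v) = l N"
    by (simp add: grad sym[of p N])
  then show ?thesis by (simp add: hessian_def l_def)
qed

section \<open>Functions of class \<open>C\<^sup>2\<close>\<close>

lemma C1_on_cong:
  assumes "open S" "\<And>x. x \<in> S \<Longrightarrow> f x = g x" "C1_on S g"
  shows "C1_on S f"
proof -
  have "dir_deriv f x v = dir_deriv g x v" if "x \<in> S" for x v
    using assms that by (intro dir_deriv_cong_open[of S]) auto
  moreover have "f differentiable (at x)" if "x \<in> S" for x
    using assms that unfolding C1_on_def differentiable_def
    by (metis (no_types, lifting) has_derivative_transform_within_open)
  ultimately show ?thesis
    using assms by (simp add: C1_on_def cong: continuous_on_cong)
qed

lemma C1_on_continuous: "C1_on S f \<Longrightarrow> continuous_on S f"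
  by (auto simp: C1_on_def intro!: differentiable_imp_continuous_on
      simp: differentiable_on_def differentiable_at_withinI)

lemma C2_on_C1: "C2_on S f \<Longrightarrow> C1_on S f"
  by (auto simp: C2_on_def C1_on_def[of _ f] C1_on_continuous)

lemma C1_on_add:
  assumes f: "C1_on S f" and g: "C1_on S g"
  shows "C1_on S (\<lambda>x. f x + g x)"
  using assms unfolding C1_on_def
  by (auto simp: dir_deriv_add intro!: continuous_intros cong: continuous_on_cong)

lemma C1_on_mult:
  assumes f: "C1_on S f" and g: "C1_on S g"
  shows "C1_on S (\<lambda>x. f x * g x)"
  using C1_on_continuous[OF f] C1_on_continuous[OF g] assms unfolding C1_on_def
  by (auto simp: dir_deriv_mult intro!: continuous_intros cong: continuous_on_cong)

lemma C2_on_mult: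
  assumes S: "open S" and f: "C2_on S f" and g: "C2_on S g"
  shows "C2_on S (\<lambda>x. f x * g x)"
  unfolding C2_on_def
proof (intro conjI ballI allI)
  show "(\<lambda>x. f x * g x) differentiable (at x)" if "x \<in> S" for x
    using f g that by (auto simp: C2_on_def)
  show "C1_on S (\<lambda>x. dir_deriv (\<lambda>x. f x * g x) x v)" for v
  proof (rule C1_on_cong[OF S])
    show "dir_deriv (\<lambda>x. f x * g x) x v = f x * dir_deriv g x v + dir_deriv f x v * g x"
      if "x \<in> S" for x
      using f g that by (intro dir_deriv_mult) (auto simp: C2_on_def)
    show "C1_on S (\<lambda>x. f x * dir_deriv g x v + dir_deriv f x v * g x)"
      using f g C2_on_C1[OF f] C2_on_C1[OF g]
      by (intro C1_on_add C1_on_mult) (auto simp: C2_on_def)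
  qed
qed

lemma C2_onI:
  assumes S: "open S"
    and 1: "\<And>x. x \<in> S \<Longrightarrow> (f has_derivative f' x) (at x)"
    and 2: "\<And>x v. x \<in> S \<Longrightarrow> ((\<lambda>x. f' x v) has_derivative f'' x v) (at x)"
    and 3: "\<And>v w. continuous_on S (\<lambda>x. f'' x v w)"
  shows "C2_on S f"
  unfolding C2_on_def
proof (intro conjI ballI allI)
  show "f differentiable (at x)" if "x \<in> S" for x
    using 1[OF that] by (auto simp: differentiable_def)
  show "C1_on S (\<lambda>x. dir_deriv f x v)" for v
  proof (rule C1_on_cong[OF S])
    show "dir_deriv f x v = f' x v" if "x \<in> S" for x
      using 1[OF that] by (rule dir_deriv_eq)
    show "C1_on S (\<lambda>x. f' x v)"
      unfolding C1_on_def
      using 2 3 by (auto simp: dir_deriv_eq[OF 2] differentiable_def cong: continuous_on_cong)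
  qed
qed

lemma dir_deriv_fst:
  fixes f :: "'a::euclidean_space \<Rightarrow> real" and p :: "'a \<times> 'b::euclidean_space"
  assumes "f differentiable (at (fst p))"
  shows "dir_deriv (\<lambda>q. f (fst q)) p v = dir_deriv f (fst p) (fst v)"
proof (rule dir_deriv_eq)
  have "(f has_derivative frechet_derivative f (at (fst p))) (at (fst p))"
    using assms by (simp add: frechet_derivative_works)
  from has_derivative_compose[OF has_derivative_fst[OF has_derivative_ident] this]
  show "((\<lambda>q. f (fst q)) has_derivative (\<lambda>v. dir_deriv f (fst p) (fst v))) (at p)" .
qed

lemma dir_deriv2_fst:
  fixes f :: "'a::euclidean_space \<Rightarrow> real" and p :: "'a \<times> 'b::euclidean_space"
  assumes S: "open S" "fst p \<in> S" and f: "C2_on S f"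
  shows "dir_deriv (\<lambda>q. dir_deriv (\<lambda>q. f (fst q)) q v) p w
           = dir_deriv (\<lambda>x. dir_deriv f x (fst v)) (fst p) (fst w)"
proof -
  have "dir_deriv (\<lambda>q. dir_deriv (\<lambda>q. f (fst q)) q v) p w
      = dir_deriv (\<lambda>q::'a\<times>'b. dir_deriv f (fst q) (fst v)) p w"
    using S f by (intro dir_deriv_cong_open[of "S \<times> UNIV"] dir_deriv_fst)
      (auto simp: C2_on_def open_Times mem_Times_iff)
  also have "\<dots> = dir_deriv (\<lambda>x. dir_deriv f x (fst v)) (fst p) (fst w)"
    using S f by (intro dir_deriv_fst) (auto simp: C2_on_def C1_on_def)
  finally show ?thesis .
qed

text \<open>On its zero set, multiplication of a function \<open>f\<close> by a factor \<open>h\<close> multiplies the Hessian in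
  tangent directions by \<open>h\<close>.\<close>

lemma hessian_mult_zero:
  fixes f h :: "'a::euclidean_space \<Rightarrow> real" and p :: "'a \<times> 'b::euclidean_space"
  assumes S: "open S" "fst p \<in> S" and f: "C2_on S f" and h: "C2_on S h"
    and 0: "f (fst p) = 0" "dir_deriv f (fst p) (fst v) = 0"
  shows "hessian g (\<lambda>q. f (fst q) * h (fst q)) p v v
           = h (fst p) * hessian g (\<lambda>q. f (fst q)) p v v"
proof -
  let ?x = "fst p" and ?v = "fst v"
  have df: "f differentiable (at x)" "h differentiable (at x)"
    "(\<lambda>x. dir_deriv f x ?v) differentiable (at x)" "(\<lambda>x. dir_deriv h x ?v) differentiable (at x)"
    if "x \<in> S" for x
    using f h that by (auto simp: C2_on_def C1_on_def)
  note dx = df[OF S(2)]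
  have fh: "C2_on S (\<lambda>x. f x * h x)" using S(1) f h by (rule C2_on_mult)
  have "dir_deriv (\<lambda>x. dir_deriv (\<lambda>x. f x * h x) x ?v) ?x ?v
      = dir_deriv (\<lambda>x. f x * dir_deriv h x ?v + dir_deriv f x ?v * h x) ?x ?v"
    using S df by (intro dir_deriv_cong_open[of S] dir_deriv_mult)
  also have "\<dots> = h ?x * dir_deriv (\<lambda>x. dir_deriv f x ?v) ?x ?v"
    using dx 0 by (simp add: dir_deriv_add dir_deriv_mult differentiable_mult)
  finally have 2: "dir_deriv (\<lambda>q. dir_deriv (\<lambda>q. f (fst q) * h (fst q)) q v) p v
      = h ?x * dir_deriv (\<lambda>q. dir_deriv (\<lambda>q. f (fst q)) q v) p v"
    using dir_deriv2_fst[OF S fh] dir_deriv2_fst[OF S f] by simp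
  have 1: "dir_deriv (\<lambda>q. f (fst q) * h (fst q)) p w = h ?x * dir_deriv (\<lambda>q. f (fst q)) p w" for w
  proof -
    have "(\<lambda>q. f (fst q) * h (fst q)) = (\<lambda>q. (\<lambda>x. f x * h x) (fst q))" by simp
    then show ?thesis
      using dir_deriv_fst[of "\<lambda>x. f x * h x" p w] dx 0
      by (simp add: dir_deriv_fst dir_deriv_mult)
  qed
  show ?thesis by (simp add: hessian_def 1 2 algebra_simps)
qed

text \<open>Near a zero at which its differential does not vanish, a function takes positive values.\<close>

lemma regular_zero_frontier:
  fixes f :: "'a::euclidean_space \<Rightarrow> real"
  assumes S: "open S" and f: "C2_on S f"
    and reg: "\<And>x. x \<in> S \<Longrightarrow> f x = 0 \<Longrightarrow> \<exists>v. dir_deriv f x v \<noteq> 0"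
  shows "open {x \<in> S. f x > 0}" and "{x \<in> S. f x = 0} = S \<inter> frontier {x \<in> S. f x > 0}"
proof -
  let ?D = "{x \<in> S. f x > 0}"
  have cont: "continuous_on S f" using f C1_on_continuous C2_on_C1 by blast
  have "open (S \<inter> f -` {0<..})"
    using cont S by (simp add: continuous_on_open_vimage Int_commute)
  moreover have "S \<inter> f -` {0<..} = ?D" by auto
  ultimately show op: "open ?D" by simp
  have "x \<in> closure ?D" if x: "x \<in> S" "f x = 0" for x
  proof -
    obtain v0 where v0: "dir_deriv f x v0 \<noteq> 0" using reg x by blast
    have D: "(f has_derivative frechet_derivative f (at x)) (at x)"
      using f x by (simp add: C2_on_def frechet_derivative_works)
    have lin: "linear (frechet_derivative f (at x))" using D by (rule has_derivative_linear)
    obtain v where v: "dir_deriv f x v > 0"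
    proof (cases "dir_deriv f x v0 > 0")
      case False
      then have "dir_deriv f x (- v0) > 0" using v0 linear_neg[OF lin] by simp
      then show ?thesis by (rule that)
    qed (rule that)
    have "((\<lambda>s. x + s *\<^sub>R v) has_derivative (\<lambda>s. s *\<^sub>R v)) (at 0)"
      by (auto intro!: derivative_eq_intros)
    from has_derivative_compose[OF this, of f "frechet_derivative f (at x)"]
    have "((\<lambda>s. f (x + s *\<^sub>R v)) has_derivative (\<lambda>s. dir_deriv f x (s *\<^sub>R v))) (at 0)"
      using D by simp
    then have "((\<lambda>s. f (x + s *\<^sub>R v)) has_real_derivative dir_deriv f x v) (at 0)"
      by (simp add: has_field_derivative_def linear_cmul[OF lin] mult_commute_abs)
    from DERIV_pos_inc_right[OF this v] obtain d where d: "d > 0"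
      "\<And>s. 0 < s \<Longrightarrow> s < d \<Longrightarrow> f (x + s *\<^sub>R v) > 0"
      using x by auto
    have "((\<lambda>s. x + s *\<^sub>R v) \<longlongrightarrow> x + 0 *\<^sub>R v) (at_right 0)"
      by (intro tendsto_intros)
    then have lim: "((\<lambda>s. x + s *\<^sub>R v) \<longlongrightarrow> x) (at_right 0)" by simp
    have "\<forall>\<^sub>F s in at_right 0. x + s *\<^sub>R v \<in> ?D"
      using topological_tendstoD[OF lim S x(1)] eventually_at_right_less[of "0::real"]
        eventually_at_right_field[THEN iffD2, OF exI[of _ d], of "0::real" "\<lambda>s. s < d"] d
      by (auto elim: eventually_elim2 simp: eventually_conj_iff)
    then show ?thesis
      using closure_subset[of ?D]
      by (intro Lim_in_closed_set[OF closed_closure _ trivial_limit_at_right_real lim])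
         (auto elim!: eventually_mono)
  qed
  moreover have "f x = 0" if x: "x \<in> S" "x \<in> closure ?D" "x \<notin> ?D" for x
  proof (rule ccontr)
    assume "f x \<noteq> 0"
    then have neg: "f x < 0" using x by auto
    have "open (S \<inter> f -` {..<0})"
      using cont S by (simp add: continuous_on_open_vimage Int_commute)
    moreover have "(S \<inter> f -` {..<0}) \<inter> ?D = {}" by auto
    ultimately have "(S \<inter> f -` {..<0}) \<inter> closure ?D = {}"
      by (simp add: open_Int_closure_eq_empty)
    then show False using x neg by auto
  qed
  ultimately show "{x \<in> S. f x = 0} = S \<inter> frontier ?D"
    using op by (auto simp: frontier_def interior_open)
qed

section \<open>The Kerr metric in Cartesian coordinates\<close>

lemma inner3: "v \<bullet> w = v $ 1 * w $ 1 + v $ 2 * w $ 2 + v $ 3 * w $ 3" for v w :: "real^3"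
  by (simp add: inner_vec_def sum_3)

text \<open>The function \<open>\<rho>\<^sup>2 = r\<^sup>2 + a\<^sup>2 cos\<^sup>2\<theta>\<close>. In this section a primed function is the derivative at
  \<open>x\<close> of the unprimed one; its last argument is the direction of differentiation.\<close>

definition kerr_rho2 :: "real \<Rightarrow> real^3 \<Rightarrow> real" where
  "kerr_rho2 a x = (norm x)\<^sup>2 + a\<^sup>2 * (x $ 3)\<^sup>2 / (norm x)\<^sup>2"

definition kerr_rho2' :: "real \<Rightarrow> real^3 \<Rightarrow> real^3 \<Rightarrow> real" where
  "kerr_rho2' a x w = 2 * (x \<bullet> w)
     + a\<^sup>2 * (2 * x $ 3 * w $ 3 / (norm x)\<^sup>2 - 2 * (x $ 3)\<^sup>2 * (x \<bullet> w) / (norm x) ^ 4)"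

text \<open>The numerator \<open>x\<^sub>1 dx\<^sub>2 - x\<^sub>2 dx\<^sub>1\<close> of the form \<open>\<eta> = sin\<^sup>2\<theta> d\<phi>\<close>, which is \<open>eta\<close>.\<close>

definition rot :: "real^3 \<Rightarrow> real^3 \<Rightarrow> real" where
  "rot x u = x $ 1 * u $ 2 - x $ 2 * u $ 1"

definition eta :: "real^3 \<Rightarrow> real^3 \<Rightarrow> real" where
  "eta x u = rot x u / (norm x)\<^sup>2"

definition eta' :: "real^3 \<Rightarrow> real^3 \<Rightarrow> real^3 \<Rightarrow> real" where
  "eta' x u w = rot w u / (norm x)\<^sup>2 - 2 * rot x u * (x \<bullet> w) / (norm x) ^ 4"

text \<open>The coefficients in the following form of the metric, in which the radial coefficient
  \<open>B = \<rho>\<^sup>2/\<Delta>\<close> is distributed over the two last terms: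
  \[ -dt^2 + A (dt - a\eta)^2 + a^2\eta^2 + E (x \cdot dx)^2 + C |dx|^2. \]
  The lemma \<open>kerr_metric_eq\<close> states this form.\<close>

definition kerr_A :: "real \<Rightarrow> real \<Rightarrow> real^3 \<Rightarrow> real" where
  "kerr_A m a x = 2 * m * norm x / kerr_rho2 a x"

definition kerr_A' :: "real \<Rightarrow> real \<Rightarrow> real^3 \<Rightarrow> real^3 \<Rightarrow> real" where
  "kerr_A' m a x w = 2 * m * (x \<bullet> w / norm x) / kerr_rho2 a x
     - 2 * m * norm x * kerr_rho2' a x w / (kerr_rho2 a x)\<^sup>2"

definition kerr_B :: "real \<Rightarrow> real \<Rightarrow> real^3 \<Rightarrow> real" where
  "kerr_B m a x = kerr_rho2 a x / kerr_Delta m a (norm x)"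

definition kerr_B' :: "real \<Rightarrow> real \<Rightarrow> real^3 \<Rightarrow> real^3 \<Rightarrow> real" where
  "kerr_B' m a x w = kerr_rho2' a x w / kerr_Delta m a (norm x)
     - kerr_rho2 a x * (2 * (norm x - m) * (x \<bullet> w / norm x)) / (kerr_Delta m a (norm x))\<^sup>2"

definition kerr_C :: "real \<Rightarrow> real^3 \<Rightarrow> real" where
  "kerr_C a x = kerr_rho2 a x / (norm x)\<^sup>2"

definition kerr_C' :: "real \<Rightarrow> real^3 \<Rightarrow> real^3 \<Rightarrow> real" where
  "kerr_C' a x w = kerr_rho2' a x w / (norm x)\<^sup>2 - 2 * kerr_rho2 a x * (x \<bullet> w) / (norm x) ^ 4"

definition kerr_E :: "real \<Rightarrow> real \<Rightarrow> real^3 \<Rightarrow> real" where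
  "kerr_E m a x = (kerr_B m a x - kerr_C a x) / (norm x)\<^sup>2"

definition kerr_E' :: "real \<Rightarrow> real \<Rightarrow> real^3 \<Rightarrow> real^3 \<Rightarrow> real" where
  "kerr_E' m a x w = (kerr_B' m a x w - kerr_C' a x w) / (norm x)\<^sup>2
     - 2 * (kerr_B m a x - kerr_C a x) * (x \<bullet> w) / (norm x) ^ 4"

lemma kerr_metric_eq:
  "kerr_metric m a (x, t) (u, \<tau>) (v, \<sigma>) =
     - \<tau> * \<sigma> + kerr_A m a x * (\<tau> - a * eta x u) * (\<sigma> - a * eta x v)
     + a\<^sup>2 * eta x u * eta x v + kerr_E m a x * (x \<bullet> u) * (x \<bullet> v) + kerr_C a x * (u \<bullet> v)"
proof (cases "x = 0")
  case False
  have *: "B * (p / r) * (q / r) + \<rho> * (k - p / r * (q / r)) / r\<^sup>2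
      = (B - \<rho> / r\<^sup>2) / r\<^sup>2 * p * q + \<rho> / r\<^sup>2 * k" if "r \<noteq> 0" for B p q r \<rho> k :: real
    using that by (simp add: field_simps power2_eq_square)
  have "(norm x)\<^sup>2 + a\<^sup>2 * (cos_polar x)\<^sup>2 = kerr_rho2 a x"
    by (simp add: kerr_rho2_def cos_polar_def power_divide)
  then show ?thesis
    using *[of "norm x" "kerr_B m a x" "x \<bullet> u" "x \<bullet> v" "kerr_rho2 a x" "u \<bullet> v"] False
    by (simp add: kerr_metric_def Let_def kerr_A_def kerr_B_def kerr_C_def kerr_E_def eta_def rot_def mult_ac)
qed (simp add: kerr_metric_def kerr_A_def kerr_C_def kerr_E_def eta_def)

text \<open>The derivative, in the spatial direction \<open>w\<close>, of the value of the metric on two constant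
  vectors.\<close>

definition kerr_metric' ::
  "real \<Rightarrow> real \<Rightarrow> real^3 \<Rightarrow> (real^3) \<times> real \<Rightarrow> (real^3) \<times> real \<Rightarrow> real^3 \<Rightarrow> real" where
  "kerr_metric' m a x = (\<lambda>(u, \<tau>) (v, \<sigma>) w.
     kerr_A' m a x w * (\<tau> - a * eta x u) * (\<sigma> - a * eta x v)
     - a * kerr_A m a x * (eta' x u w * (\<sigma> - a * eta x v) + (\<tau> - a * eta x u) * eta' x v w)
     + a\<^sup>2 * (eta' x u w * eta x v + eta x u * eta' x v w)
     + kerr_E' m a x w * (x \<bullet> u) * (x \<bullet> v)
     + kerr_E m a x * ((w \<bullet> u) * (x \<bullet> v) + (x \<bullet> u) * (w \<bullet> v))
     + kerr_C' a x w * (u \<bullet> v))"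

lemma norm_has_derivative:
  fixes x :: "'a::real_inner"
  assumes "x \<noteq> 0"
  shows "(norm has_derivative (\<lambda>w. x \<bullet> w / norm x)) (at x)"
  using has_derivative_norm[OF assms] by (simp add: sgn_div_norm inner_commute divide_inverse mult.commute)

lemma vec_nth_has_derivative: "((\<lambda>x::real^'n. x $ i) has_derivative (\<lambda>w. w $ i)) (at x)"
  by (rule bounded_linear_imp_has_derivative[OF bounded_linear_vec_nth])

lemma kerr_rho2_pos: "x \<noteq> 0 \<Longrightarrow> kerr_rho2 a x > 0"
  unfolding kerr_rho2_def by (intro add_pos_nonneg) auto

lemma has_derivative_quotient:
  fixes f g :: "'a::real_normed_vector \<Rightarrow> real"
  assumes "(f has_derivative f') (at x)" "(g has_derivative g') (at x)" "g x \<noteq> 0"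
  shows "((\<lambda>x. f x / g x) has_derivative (\<lambda>w. f' w / g x - f x * g' w / (g x)\<^sup>2)) (at x)"
  by (rule has_derivative_eq_rhs[OF has_derivative_divide'[OF assms]])
     (use assms(3) in \<open>simp add: fun_eq_iff diff_divide_distrib power2_eq_square\<close>)

lemma norm2_has_derivative:
  "((\<lambda>x::'a::real_inner. (norm x)\<^sup>2) has_derivative (\<lambda>w. 2 * (x \<bullet> w))) (at x)"
  unfolding power2_norm_eq_inner
  by (auto intro!: derivative_eq_intros simp: inner_commute)

lemma kerr_rho2_has_derivative:
  assumes "x \<noteq> 0"
  shows "(kerr_rho2 a has_derivative kerr_rho2' a x) (at x)"
proof -
  have "((\<lambda>x::real^3. (x $ 3)\<^sup>2) has_derivative (\<lambda>w. 2 * x $ 3 * w $ 3)) (at x)"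
    by (auto intro!: derivative_eq_intros vec_nth_has_derivative)
  from has_derivative_quotient[OF this norm2_has_derivative]
  have q: "((\<lambda>x. (x $ 3)\<^sup>2 / (norm x)\<^sup>2) has_derivative
     (\<lambda>w. 2 * x $ 3 * w $ 3 / (norm x)\<^sup>2 - (x $ 3)\<^sup>2 * (2 * (x \<bullet> w)) / ((norm x)\<^sup>2)\<^sup>2)) (at x)"
    using assms by simp
  have eq: "kerr_rho2 a = (\<lambda>x. (norm x)\<^sup>2 + a\<^sup>2 * ((x $ 3)\<^sup>2 / (norm x)\<^sup>2))"
    by (simp add: kerr_rho2_def fun_eq_iff)
  show ?thesis
    unfolding eq
    by (rule has_derivative_eq_rhs[OF has_derivative_add[OF norm2_has_derivative
          has_derivative_mult_right[OF q]]])
       (simp add: kerr_rho2'_def fun_eq_iff power_mult[symmetric])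
qed

lemma rot_has_derivative: "((\<lambda>x. rot x u) has_derivative (\<lambda>w. rot w u)) (at x)"
  unfolding rot_def by (auto intro!: derivative_eq_intros vec_nth_has_derivative)

lemma eta_has_derivative:
  assumes "x \<noteq> 0"
  shows "((\<lambda>x. eta x u) has_derivative eta' x u) (at x)"
  unfolding eta_def
  by (rule has_derivative_eq_rhs[OF has_derivative_quotient[OF rot_has_derivative norm2_has_derivative]])
     (use assms in \<open>auto simp: fun_eq_iff eta'_def power_mult[symmetric]\<close>)

lemma kerr_A_has_derivative:
  assumes "x \<noteq> 0"
  shows "(kerr_A m a has_derivative kerr_A' m a x) (at x)"
  unfolding kerr_A_def[abs_def]
  by (rule has_derivative_eq_rhs[OF has_derivative_quotient[OF
        has_derivative_mult_right[OF norm_has_derivative] kerr_rho2_has_derivative]])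
     (use assms kerr_rho2_pos[OF assms, of a] in \<open>auto simp: fun_eq_iff kerr_A'_def\<close>)

lemma kerr_C_has_derivative:
  assumes "x \<noteq> 0"
  shows "(kerr_C a has_derivative kerr_C' a x) (at x)"
  unfolding kerr_C_def[abs_def]
  by (rule has_derivative_eq_rhs[OF has_derivative_quotient[OF
        kerr_rho2_has_derivative norm2_has_derivative]])
     (use assms in \<open>auto simp: fun_eq_iff kerr_C'_def power_mult[symmetric]\<close>)

lemma kerr_B_has_derivative:
  assumes "x \<noteq> 0" "kerr_Delta m a (norm x) \<noteq> 0"
  shows "(kerr_B m a has_derivative kerr_B' m a x) (at x)"
proof -
  have D: "((\<lambda>x. kerr_Delta m a (norm x)) has_derivative (\<lambda>w. 2 * (norm x - m) * (x \<bullet> w / norm x))) (at x)"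
    unfolding kerr_Delta_def
    by (rule has_derivative_eq_rhs, (rule derivative_intros norm_has_derivative | simp add: assms)+)
       (auto simp: fun_eq_iff algebra_simps diff_divide_distrib)
  show ?thesis
    unfolding kerr_B_def[abs_def]
    by (rule has_derivative_eq_rhs[OF has_derivative_quotient[OF kerr_rho2_has_derivative D]])
       (use assms in \<open>auto simp: fun_eq_iff kerr_B'_def\<close>)
qed

lemma kerr_E_has_derivative:
  assumes "x \<noteq> 0" "kerr_Delta m a (norm x) \<noteq> 0"
  shows "(kerr_E m a has_derivative kerr_E' m a x) (at x)"
  unfolding kerr_E_def[abs_def]
  by (rule has_derivative_eq_rhs[OF has_derivative_quotient[OF has_derivative_diff[OF
        kerr_B_has_derivative kerr_C_has_derivative] norm2_has_derivative]])
     (use assms in \<open>auto simp: fun_eq_iff kerr_E'_def power_mult[symmetric]\<close>)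

lemma kerr_metric_has_derivative:
  assumes "x \<noteq> 0" "kerr_Delta m a (norm x) \<noteq> 0"
  shows "((\<lambda>q. kerr_metric m a q v w) has_derivative (\<lambda>u. kerr_metric' m a x v w (fst u))) (at (x, t))"
proof -
  obtain v1 v2 w1 w2 where vw: "v = (v1, v2)" "w = (w1, w2)" by fastforce
  have eq: "kerr_metric m a q v w = - v2 * w2 + kerr_A m a (fst q) * (v2 - a * eta (fst q) v1) * (w2 - a * eta (fst q) w1)
     + a\<^sup>2 * eta (fst q) v1 * eta (fst q) w1 + kerr_E m a (fst q) * (fst q \<bullet> v1) * (fst q \<bullet> w1)
     + kerr_C a (fst q) * (v1 \<bullet> w1)" for q
    unfolding vw by (cases q) (simp add: kerr_metric_eq)
  have fst: "((\<lambda>q. f (fst q)) has_derivative (\<lambda>u. f' (fst u))) (at (x, t))"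
    if "(f has_derivative f') (at x)" for f :: "real^3 \<Rightarrow> real" and f'
    using has_derivative_compose[OF has_derivative_fst[OF has_derivative_ident], of f f' "(x, t)" UNIV] that
    by simp
  note d = fst[OF kerr_A_has_derivative[OF assms(1)]] fst[OF kerr_C_has_derivative[OF assms(1)]]
    fst[OF kerr_E_has_derivative[OF assms]] fst[OF eta_has_derivative[OF assms(1)]]
  show ?thesis
    unfolding eq
    by (rule has_derivative_eq_rhs, (rule derivative_intros d)+)
       (auto simp: fun_eq_iff kerr_metric'_def vw algebra_simps)
qed

lemma rot_add: "rot x (u + v) = rot x u + rot x v" and rot_scale: "rot x (c *\<^sub>R u) = c * rot x u"
  by (simp_all add: rot_def algebra_simps)

lemma eta_add: "eta x (u + v) = eta x u + eta x v" and eta_scale: "eta x (c *\<^sub>R u) = c * eta x u"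
  by (simp_all add: eta_def rot_add rot_scale add_divide_distrib)

lemma kerr_metric_sym: "kerr_metric m a q v w = kerr_metric m a q w v"
  by (cases q; cases v; cases w) (simp add: kerr_metric_eq inner_commute algebra_simps)

lemma kerr_metric_bilinear: "bilinear (kerr_metric m a q)"
proof -
  have "linear (kerr_metric m a q v)" for v
    by (rule linearI; cases q; cases v)
      (auto simp: kerr_metric_eq eta_add eta_scale inner_add_right algebra_simps)
  then show ?thesis by (simp add: bilinear_def kerr_metric_sym[of m a q _ v for v])
qed

lemma cos_polar_le1: "(cos_polar x)\<^sup>2 \<le> 1"
proof -
  have "\<bar>cos_polar x\<bar> \<le> 1"
    using component_le_norm_cart[of x 3] by (auto simp: cos_polar_def divide_le_eq_1)
  then show ?thesis by (simp add: abs_square_le_1)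
qed

lemma kerr_slice_pos:
  assumes "m > 0" "a\<^sup>2 < m\<^sup>2" "x \<in> kerr_slice m a"
  shows "norm x > m" "x \<noteq> 0" "kerr_Delta m a (norm x) > 0"
proof -
  let ?s = "sqrt (m\<^sup>2 - a\<^sup>2 * (cos_polar x)\<^sup>2)"
  have ac: "a\<^sup>2 * (cos_polar x)\<^sup>2 \<le> a\<^sup>2"
    using cos_polar_le1 by (simp add: mult_left_le)
  then have s: "?s \<ge> 0" "?s\<^sup>2 \<ge> m\<^sup>2 - a\<^sup>2" using assms(2) by auto
  have r: "norm x - m > ?s" using assms(3) by (simp add: kerr_slice_def)
  with s show "norm x > m" by linarith
  with assms(1) show "x \<noteq> 0" by auto
  have "(norm x - m)\<^sup>2 > ?s\<^sup>2" using r s by (intro power_strict_mono) auto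
  with s show "kerr_Delta m a (norm x) > 0"
    by (simp add: kerr_Delta_def power2_eq_square algebra_simps)
qed

text \<open>A vector orthogonal to everything is orthogonal to its own spatial part \<open>u\<close> and to
  \<open>\<partial>\<^sub>t\<close>; as \<open>\<partial>\<^sub>t\<close> is timelike this makes the square of \<open>u\<close> nonpositive.\<close>

lemma kerr_metric_nondegenerate:
  assumes "m > 0" "a\<^sup>2 < m\<^sup>2" "x \<in> kerr_slice m a" and 0: "\<And>w. kerr_metric m a (x, t) y w = 0"
  shows "y = 0"
proof -
  let ?g = "kerr_metric m a (x, t)"
  obtain u \<tau> where y: "y = (u, \<tau>)" by fastforce
  note stat = kerr_standard_stationary[OF assms(1-3), where t = t]
  have split: "?g y w = ?g (u, 0) w + \<tau> * ?g (0, 1) w" for w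
    using bilinear_ladd[OF kerr_metric_bilinear, of m a "(x, t)" "(u, 0)" "\<tau> *\<^sub>R (0, 1)" w]
      bilinear_lmul[OF kerr_metric_bilinear, of m a "(x, t)" \<tau> "(0, 1)" w]
    by (simp add: y)
  have 1: "?g (u, 0) (u, 0) + \<tau> * ?g (0, 1) (u, 0) = 0" using split 0 by metis
  have 2: "?g (u, 0) (0, 1) + \<tau> * ?g (0, 1) (0, 1) = 0" using split 0 by metis
  from 2 have "?g (0, 1) (u, 0) = - \<tau> * ?g (0, 1) (0, 1)"
    by (simp add: kerr_metric_sym[of m a _ "(u, 0)"])
  with 1 have "?g (u, 0) (u, 0) = \<tau>\<^sup>2 * ?g (0, 1) (0, 1)" by (simp add: power2_eq_square)
  also have "\<dots> \<le> 0" using stat(1) by (simp add: mult_nonneg_nonpos)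
  finally have "u = 0" using stat(2)[of u] by force
  with 2 stat(1) show ?thesis
    by (auto simp: y kerr_metric_eq eta_def rot_def zero_prod_def)
qed

text \<open>The gradient of \<open>\<phi>\<close> is assumed to be a purely spatial vector \<open>n\<close> without rotational
  component.\<close>

lemma kerr_hessian:
  assumes "m > 0" "a\<^sup>2 < m\<^sup>2" "x \<in> kerr_slice m a"
    and S: "open S" "x \<in> S" and \<phi>: "C2_on S \<phi>"
    and grad: "\<And>w. dir_deriv \<phi> x w = kerr_E m a x * (x \<bullet> n) * (x \<bullet> w) + kerr_C a x * (n \<bullet> w)"
    and n: "rot x n = 0"
  shows "hessian (kerr_metric m a) (\<lambda>q. \<phi> (fst q)) (x, t) v v =
     dir_deriv (\<lambda>y. dir_deriv \<phi> y (fst v)) x (fst v)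
     - kerr_metric' m a x v (n, 0) (fst v) + kerr_metric' m a x v v n / 2"
proof -
  note pos = kerr_slice_pos[OF assms(1-3)]
  have der: "((\<lambda>q. kerr_metric m a q v w) has_derivative (\<lambda>u. kerr_metric' m a x v w (fst u))) (at (x, t))" for v w
    using pos by (intro kerr_metric_has_derivative) auto
  have "hessian (kerr_metric m a) (\<lambda>q. \<phi> (fst q)) (x, t) v v =
     dir_deriv (\<lambda>q. dir_deriv (\<lambda>q. \<phi> (fst q)) q v) (x, t) v
     - dir_deriv (\<lambda>q. kerr_metric m a q v (n, 0)) (x, t) v
     + dir_deriv (\<lambda>q. kerr_metric m a q v v) (x, t) (n, 0) / 2"
  proof (rule hessian_eq_gradient)
    show "dir_deriv (\<lambda>q. \<phi> (fst q)) (x, t) w = kerr_metric m a (x, t) (n, 0) w" for w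
      using S \<phi> by (cases w) (simp add: dir_deriv_fst C2_on_def grad kerr_metric_eq eta_def n)
    show "y = 0" if "\<And>w. kerr_metric m a (x, t) y w = 0" for y
      using kerr_metric_nondegenerate[OF assms(1-3)] that by blast
    show "(\<lambda>q. kerr_metric m a q v w) differentiable at (x, t)" for v w
      using der differentiable_def by blast
  qed (rule kerr_metric_bilinear kerr_metric_sym)+
  then show ?thesis
    using dir_deriv2_fst[of S "(x, t)", OF _ _ \<phi>] S by (simp add: dir_deriv_eq[OF der])
qed

section \<open>Spheres far from the black hole\<close>

lemma kerr_B_decomp: "x \<noteq> 0 \<Longrightarrow> kerr_E m a x * (norm x)\<^sup>2 + kerr_C a x = kerr_B m a x"
  by (simp add: kerr_E_def)

lemma rot_scale_left: "rot (c *\<^sub>R x) u = c * rot x u" and rot_swap: "rot u x = - rot x u"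
    and rot_self: "rot x x = 0"
  by (simp_all add: rot_def algebra_simps)

lemma kerr_A'_scale: "kerr_A' m a x (c *\<^sub>R w) = c * kerr_A' m a x w"
  and kerr_C'_scale: "kerr_C' a x (c *\<^sub>R w) = c * kerr_C' a x w"
  and kerr_E'_scale: "kerr_E' m a x (c *\<^sub>R w) = c * kerr_E' m a x w"
  and eta'_scale: "eta' x u (c *\<^sub>R w) = c * eta' x u w" "eta' x (c *\<^sub>R u) w = c * eta' x u w"
proof -
  have rho: "kerr_rho2' a x (c *\<^sub>R w) = c * kerr_rho2' a x w"
    by (simp add: kerr_rho2'_def algebra_simps)
  have B: "kerr_B' m a x (c *\<^sub>R w) = c * kerr_B' m a x w"
    by (simp add: kerr_B'_def rho right_diff_distrib mult_ac)
  show "kerr_A' m a x (c *\<^sub>R w) = c * kerr_A' m a x w"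
    by (simp add: kerr_A'_def rho right_diff_distrib mult_ac)
  show C: "kerr_C' a x (c *\<^sub>R w) = c * kerr_C' a x w"
    by (simp add: kerr_C'_def rho right_diff_distrib mult_ac)
  show "kerr_E' m a x (c *\<^sub>R w) = c * kerr_E' m a x w"
    unfolding kerr_E'_def B C by (simp add: right_diff_distrib diff_divide_distrib mult_ac)
  show "eta' x u (c *\<^sub>R w) = c * eta' x u w"
    by (simp add: eta'_def rot_scale_left right_diff_distrib mult_ac)
  show "eta' x (c *\<^sub>R u) w = c * eta' x u w"
    by (simp add: eta'_def rot_scale right_diff_distrib mult_ac)
qed

lemma kerr_rho2'_radial: "x \<noteq> 0 \<Longrightarrow> kerr_rho2' a x x = 2 * (norm x)\<^sup>2"
  by (simp add: kerr_rho2'_def power2_norm_eq_inner[symmetric] power2_eq_square power4_eq_xxxx)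

lemma kerr_C'_radial: "x \<noteq> 0 \<Longrightarrow> kerr_C' a x x = 2 - 2 * kerr_C a x"
  by (simp add: kerr_C'_def kerr_C_def kerr_rho2'_radial power2_norm_eq_inner[symmetric]
      power2_eq_square power4_eq_xxxx)

lemma kerr_A'_radial:
  "x \<noteq> 0 \<Longrightarrow> kerr_A' m a x x = 2 * m * norm x * (kerr_rho2 a x - 2 * (norm x)\<^sup>2) / (kerr_rho2 a x)\<^sup>2"
  using kerr_rho2_pos[of x a]
  by (simp add: kerr_A'_def kerr_rho2'_radial power2_norm_eq_inner[symmetric] power2_eq_square
      field_simps)

text \<open>The first-order part of the Hessian when both the gradient is radial and the tangent
  vector orthogonal to it, as on the spheres about the origin.\<close>

lemma kerr_metric'_radial:
  assumes x: "x \<noteq> 0" and u: "x \<bullet> u = 0"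
  shows "- kerr_metric' m a x (u, \<tau>) (k *\<^sub>R x, 0) u + kerr_metric' m a x (u, \<tau>) (u, \<tau>) (k *\<^sub>R x) / 2
    = - k * (kerr_B m a x - 1) * (norm u)\<^sup>2 + k / 2 * kerr_A' m a x x * (\<tau> - a * eta x u)\<^sup>2"
proof -
  have 1: "eta' x x u = - eta x u" "eta' x u x = - eta x u"
    using x by (simp_all add: eta'_def eta_def rot_self u rot_swap[of u] power2_norm_eq_inner[symmetric]
        power2_eq_square power4_eq_xxxx)
  have 2: "eta x x = 0" by (simp add: eta_def rot_self)
  have u': "u \<bullet> x = 0" using u by (simp add: inner_commute)
  have C: "kerr_C a x = kerr_B m a x - kerr_E m a x * (norm x)\<^sup>2"
    using kerr_B_decomp[OF x, of m a] by simp
  show ?thesis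
    by (simp add: kerr_metric'_def eta_scale eta'_scale kerr_A'_scale kerr_C'_scale kerr_E'_scale
        1 2 u u' kerr_C'_radial[OF x] power2_norm_eq_inner[symmetric] C)
       (simp add: power2_eq_square field_simps)
qed

lemma kerr_B_pos:
  assumes "m > 0" "a\<^sup>2 < m\<^sup>2" "x \<in> kerr_slice m a"
  shows "kerr_B m a x > 0"
  using kerr_slice_pos[OF assms] kerr_rho2_pos[of x a] by (simp add: kerr_B_def)

lemma sphere_has_derivative:
  "((\<lambda>x. c - (norm x)\<^sup>2) has_derivative (\<lambda>w. - 2 * (x \<bullet> w))) (at (x :: real^3))"
  by (rule has_derivative_eq_rhs[OF has_derivative_diff[OF has_derivative_const norm2_has_derivative]]) simp

lemma sphere_has_derivative2:
  "((\<lambda>x. - 2 * (x \<bullet> v)) has_derivative (\<lambda>w. - 2 * (w \<bullet> v))) (at (x :: real^3))"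
  by (auto intro!: derivative_eq_intros)

lemma sphere_C2: "open S \<Longrightarrow> C2_on S (\<lambda>x :: real^3. c - (norm x)\<^sup>2)"
  by (rule C2_onI[OF _ sphere_has_derivative sphere_has_derivative2]) (auto intro!: continuous_intros)

lemma kerr_hessian_sphere:
  assumes "m > 0" "a\<^sup>2 < m\<^sup>2" "x \<in> kerr_slice m a" and S: "open S" "x \<in> S" and u: "x \<bullet> u = 0"
  shows "hessian (kerr_metric m a) (\<lambda>q. c - (norm (fst q))\<^sup>2) (x, t) (u, \<tau>) (u, \<tau>) =
     - (2 * (norm u)\<^sup>2 + kerr_A' m a x x * (\<tau> - a * eta x u)\<^sup>2) / kerr_B m a x"
proof -
  note x = kerr_slice_pos(2)[OF assms(1-3)]
  note B = kerr_B_pos[OF assms(1-3)]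
  \<comment> \<open>The gradient of the function at \<open>x\<close> is \<open>k x\<close>.\<close>
  define k where "k = - 2 / kerr_B m a x"
  have d1: "dir_deriv (\<lambda>x. c - (norm x)\<^sup>2) y w = - 2 * (y \<bullet> w)" for y w :: "real^3"
    by (rule dir_deriv_eq[OF sphere_has_derivative])
  have d2: "dir_deriv (\<lambda>y. dir_deriv (\<lambda>x. c - (norm x)\<^sup>2) y u) x u = - 2 * (norm u)\<^sup>2"
    unfolding d1 dir_deriv_eq[OF sphere_has_derivative2] by (simp add: power2_norm_eq_inner)
  have "dir_deriv (\<lambda>x. c - (norm x)\<^sup>2) x w
      = kerr_E m a x * (x \<bullet> (k *\<^sub>R x)) * (x \<bullet> w) + kerr_C a x * ((k *\<^sub>R x) \<bullet> w)" for w
  proof -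
    have "kerr_E m a x * (x \<bullet> (k *\<^sub>R x)) * (x \<bullet> w) + kerr_C a x * ((k *\<^sub>R x) \<bullet> w)
        = k * (kerr_E m a x * (norm x)\<^sup>2 + kerr_C a x) * (x \<bullet> w)"
      by (simp add: power2_norm_eq_inner algebra_simps)
    then show ?thesis using B by (simp add: d1 kerr_B_decomp[OF x] k_def)
  qed
  from kerr_hessian[OF assms(1-3) S sphere_C2[OF S(1)] this]
  have "hessian (kerr_metric m a) (\<lambda>q. c - (norm (fst q))\<^sup>2) (x, t) (u, \<tau>) (u, \<tau>) =
     - 2 * (norm u)\<^sup>2 - kerr_metric' m a x (u, \<tau>) (k *\<^sub>R x, 0) u
     + kerr_metric' m a x (u, \<tau>) (u, \<tau>) (k *\<^sub>R x) / 2"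
    by (simp add: rot_scale rot_self d2)
  also have "\<dots> = - 2 * (norm u)\<^sup>2 + (- k * (kerr_B m a x - 1) * (norm u)\<^sup>2
      + k / 2 * kerr_A' m a x x * (\<tau> - a * eta x u)\<^sup>2)"
    using kerr_metric'_radial[OF x u, of m a \<tau> k] by simp
  also have "\<dots> = - (2 * (norm u)\<^sup>2 + kerr_A' m a x x * (\<tau> - a * eta x u)\<^sup>2) / kerr_B m a x"
    using B by (simp add: k_def field_simps)
  finally show ?thesis .
qed

lemma rot_le: "\<bar>rot x u\<bar> \<le> norm x * norm u"
proof -
  have "(norm x * norm u)\<^sup>2 - (rot x u)\<^sup>2
      = (x $ 1 * u $ 1 + x $ 2 * u $ 2)\<^sup>2 + (x $ 3)\<^sup>2 * ((u $ 1)\<^sup>2 + (u $ 2)\<^sup>2 + (u $ 3)\<^sup>2)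
        + ((x $ 1)\<^sup>2 + (x $ 2)\<^sup>2) * (u $ 3)\<^sup>2"
    unfolding rot_def power_mult_distrib power2_norm_eq_inner inner3 by algebra
  also have "\<dots> \<ge> 0" by (intro add_nonneg_nonneg mult_nonneg_nonneg) auto
  finally show ?thesis
    using abs_le_square_iff[of "rot x u" "norm x * norm u"] by (simp add: abs_mult)
qed

text \<open>Far out the metric is close to the Minkowski metric, for which spheres are strongly
  light-convex. The constant \<open>12\<close> is not optimal.\<close>

lemma kerr_hessian_sphere_neg:
  assumes "m > 0" "a\<^sup>2 < m\<^sup>2" "x \<in> kerr_slice m a" and S: "open S" "x \<in> S" and u: "x \<bullet> u = 0"
    and r: "norm x \<ge> 12 * m"
    and null: "kerr_metric m a (x, t) (u, \<tau>) (u, \<tau>) = 0" and nz: "(u, \<tau>) \<noteq> 0"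
  shows "hessian (kerr_metric m a) (\<lambda>q. c - (norm (fst q))\<^sup>2) (x, t) (u, \<tau>) (u, \<tau>) < 0"
proof -
  note x = kerr_slice_pos(2)[OF assms(1-3)]
  note B = kerr_B_pos[OF assms(1-3)]
  define r where "r = norm x"
  define \<rho>2 where "\<rho>2 = kerr_rho2 a x"
  define T where "T = \<tau> - a * eta x u"
  have r0: "r > 0" "r \<ge> 12 * m" using x r by (simp_all add: r_def)
  have m: "m / r \<le> 1 / 12" "m / r > 0" using r0 assms(1) by (simp_all add: field_simps)
  have rho: "\<rho>2 \<ge> r\<^sup>2" by (simp add: \<rho>2_def kerr_rho2_def r_def)
  have "(x $ 3)\<^sup>2 \<le> r\<^sup>2"
    using component_le_norm_cart[of x 3] unfolding r_def by (metis abs_le_square_iff abs_norm_cancel)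
  then have "a\<^sup>2 * ((x $ 3)\<^sup>2 / r\<^sup>2) \<le> a\<^sup>2" using r0 by (intro mult_left_le) (auto simp: divide_le_eq_1)
  then have "\<rho>2 \<le> r\<^sup>2 + m\<^sup>2" using assms(2) by (simp add: \<rho>2_def kerr_rho2_def r_def)
  moreover have "m\<^sup>2 \<le> r\<^sup>2" using r0 assms(1) by (intro power_mono) auto
  ultimately have C: "kerr_C a x \<le> 2" using r0 by (simp add: kerr_C_def r_def \<rho>2_def divide_le_eq)
  have pos: "\<rho>2 > 0" using rho r0 by (smt (verit) zero_less_power)
  have A: "kerr_A m a x \<le> 2 * (m / r)"
    using frac_le[of "2 * m * r" "2 * m * r" "r\<^sup>2" \<rho>2] rho r0 assms(1)
    by (simp add: kerr_A_def r_def[symmetric] \<rho>2_def[symmetric] power2_eq_square)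
  have "\<bar>a\<bar> \<le> m" using assms(1,2) by (metis abs_le_square_iff abs_of_pos less_imp_le)
  moreover have "\<bar>eta x u\<bar> \<le> norm u / r"
    using rot_le[of x u] r0 by (simp add: eta_def r_def[symmetric] field_simps power2_eq_square)
  ultimately have "\<bar>a\<bar> * \<bar>eta x u\<bar> * \<bar>T\<bar> \<le> m * (norm u / r) * \<bar>T\<bar>"
    using assms(1) r0 by (intro mult_mono) auto
  then have "- 2 * (a * eta x u * T) \<le> 2 * (m / r * (norm u * \<bar>T\<bar>))"
    using abs_ge_minus_self[of "a * eta x u * T"] by (simp add: abs_mult)
  \<comment> \<open>Young's inequality for the mixed term of the null condition\<close>
  also have "\<dots> \<le> m / r * ((norm u)\<^sup>2 + T\<^sup>2)"
    using mult_left_mono[OF sum_squares_bound[of "norm u" "\<bar>T\<bar>"], of "m / r"] m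
    by (simp add: mult_ac)
  finally have aT: "- 2 * (a * eta x u * T) \<le> m / r * ((norm u)\<^sup>2 + T\<^sup>2)" .
  have "\<tau> = T + a * eta x u" by (simp add: T_def)
  with null have "(1 - kerr_A m a x) * T\<^sup>2 = kerr_C a x * (norm u)\<^sup>2 - 2 * (a * eta x u * T)"
    by (simp add: kerr_metric_eq u power2_norm_eq_inner)
       (simp add: power2_eq_square algebra_simps)
  also have "\<dots> \<le> 2 * (norm u)\<^sup>2 + m / r * ((norm u)\<^sup>2 + T\<^sup>2)"
    using aT mult_right_mono[OF C, of "(norm u)\<^sup>2"] by simp
  also have "\<dots> \<le> 2 * (norm u)\<^sup>2 + 1 / 12 * ((norm u)\<^sup>2 + T\<^sup>2)"
    using mult_right_mono[OF m(1), of "(norm u)\<^sup>2 + T\<^sup>2"] by simp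
  finally have "(1 - kerr_A m a x) * T\<^sup>2 \<le> 2 * (norm u)\<^sup>2 + 1 / 12 * ((norm u)\<^sup>2 + T\<^sup>2)" .
  moreover have "5 / 6 * T\<^sup>2 \<le> (1 - kerr_A m a x) * T\<^sup>2"
    using A m by (intro mult_right_mono; linarith?) auto
  ultimately have T: "T\<^sup>2 \<le> 3 * (norm u)\<^sup>2"
    using zero_le_power2[of "norm u"] by argo
  have u0: "u \<noteq> 0"
  proof
    assume "u = 0"
    then show False using T nz by (simp add: T_def eta_def rot_def zero_prod_def)
  qed
  have "kerr_A' m a x x = - (2 * m * r * (2 * r\<^sup>2 - \<rho>2) / \<rho>2\<^sup>2)"
    using x by (simp add: kerr_A'_radial r_def \<rho>2_def algebra_simps minus_divide_left)
  moreover have "2 * m * r * (2 * r\<^sup>2 - \<rho>2) / \<rho>2\<^sup>2 \<le> 2 * m * r * r\<^sup>2 / (r\<^sup>2)\<^sup>2"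
    using rho r0 assms(1) pos by (intro frac_le mult_left_mono power_mono) auto
  moreover have "2 * m * r * r\<^sup>2 / (r\<^sup>2)\<^sup>2 = 2 * (m / r)"
    using r0 by (simp add: power2_eq_square)
  ultimately have "kerr_A' m a x x \<ge> - (1 / 6)" using m by linarith
  then have "kerr_A' m a x x * T\<^sup>2 \<ge> - (1 / 6) * T\<^sup>2" by (intro mult_right_mono) auto
  moreover have "(norm u)\<^sup>2 > 0" using u0 by simp
  ultimately have "2 * (norm u)\<^sup>2 + kerr_A' m a x x * T\<^sup>2 > 0" using T by argo
  then show ?thesis
    using B unfolding kerr_hessian_sphere[OF assms(1-3) S u] T_def[symmetric]
    by (simp add: divide_neg_pos minus_divide_left[symmetric])
qed

section \<open>The inner boundary\<close>

text \<open>In the region \<open>r > m\<close>, the inner boundary is the zero set of \<open>\<rho>\<^sup>2 - 2mr - \<epsilon>\<close>.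
  The derivative and the second derivative of this function, which do not depend on \<open>\<epsilon>\<close>, carry
  one and two primes; the last argument is the direction of the last differentiation.\<close>

definition kerr_level :: "real \<Rightarrow> real \<Rightarrow> real \<Rightarrow> real^3 \<Rightarrow> real" where
  "kerr_level m a \<epsilon> x = kerr_rho2 a x - 2 * m * norm x - \<epsilon>"

definition kerr_level' :: "real \<Rightarrow> real \<Rightarrow> real^3 \<Rightarrow> real^3 \<Rightarrow> real" where
  "kerr_level' m a x w = kerr_rho2' a x w - 2 * m * (x \<bullet> w / norm x)"

definition kerr_level'' :: "real \<Rightarrow> real \<Rightarrow> real^3 \<Rightarrow> real^3 \<Rightarrow> real^3 \<Rightarrow> real" where
  "kerr_level'' m a x v w = 2 * (w \<bullet> v)
     + a\<^sup>2 * (2 * w $ 3 * v $ 3 / (norm x)\<^sup>2 - 2 * x $ 3 * v $ 3 * (2 * (x \<bullet> w)) / (norm x) ^ 4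
            - ((4 * x $ 3 * w $ 3 * (x \<bullet> v) + 2 * (x $ 3)\<^sup>2 * (w \<bullet> v)) / (norm x) ^ 4
               - 2 * (x $ 3)\<^sup>2 * (x \<bullet> v) * (4 * (norm x)\<^sup>2 * (x \<bullet> w)) / (norm x) ^ 8))
     - 2 * m * ((w \<bullet> v) / norm x - (x \<bullet> v) * (x \<bullet> w / norm x) / (norm x)\<^sup>2)"

lemma kerr_level_has_derivative:
  assumes "x \<noteq> 0"
  shows "(kerr_level m a \<epsilon> has_derivative kerr_level' m a x) (at x)"
  unfolding kerr_level_def[abs_def]
  by (rule has_derivative_eq_rhs[OF has_derivative_diff[OF has_derivative_diff[OF
          kerr_rho2_has_derivative has_derivative_mult_right[OF norm_has_derivative]]
          has_derivative_const]])
     (simp_all add: assms kerr_level'_def fun_eq_iff)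

lemma kerr_level_has_derivative2:
  assumes x: "x \<noteq> 0"
  shows "((\<lambda>x. kerr_level' m a x v) has_derivative kerr_level'' m a x v) (at x)"
proof -
  have n0: "(norm x)\<^sup>2 \<noteq> 0" "(norm x) ^ 4 \<noteq> 0" "norm x \<noteq> 0" using x by simp_all
  have 0: "((\<lambda>x. x \<bullet> v) has_derivative (\<lambda>w. w \<bullet> v)) (at x)"
    by (auto intro!: derivative_eq_intros)
  have n4: "((\<lambda>x::real^3. (norm x) ^ 4) has_derivative (\<lambda>w. 4 * (norm x)\<^sup>2 * (x \<bullet> w))) (at x)"
  proof -
    have eq: "(\<lambda>x::real^3. (norm x) ^ 4) = (\<lambda>x. (norm x)\<^sup>2 * (norm x)\<^sup>2)"
      by (simp add: power4_eq_xxxx power2_eq_square mult.assoc)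
    show ?thesis
      unfolding eq
      by (rule has_derivative_eq_rhs[OF has_derivative_mult[OF norm2_has_derivative norm2_has_derivative]])
         (simp add: fun_eq_iff)
  qed
  have "((\<lambda>x::real^3. 2 * x $ 3 * v $ 3) has_derivative (\<lambda>w. 2 * w $ 3 * v $ 3)) (at x)"
    by (auto intro!: derivative_eq_intros vec_nth_has_derivative)
  from has_derivative_quotient[OF this norm2_has_derivative n0(1)]
  have 1: "((\<lambda>x. 2 * x $ 3 * v $ 3 / (norm x)\<^sup>2) has_derivative
      (\<lambda>w. 2 * w $ 3 * v $ 3 / (norm x)\<^sup>2 - 2 * x $ 3 * v $ 3 * (2 * (x \<bullet> w)) / (norm x) ^ 4)) (at x)"
    by (simp add: power_mult[symmetric])
  have "((\<lambda>x::real^3. 2 * (x $ 3)\<^sup>2 * (x \<bullet> v)) has_derivative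
      (\<lambda>w. 4 * x $ 3 * w $ 3 * (x \<bullet> v) + 2 * (x $ 3)\<^sup>2 * (w \<bullet> v))) (at x)"
    by (auto intro!: derivative_eq_intros vec_nth_has_derivative simp: fun_eq_iff)
  from has_derivative_quotient[OF this n4 n0(2)]
  have 2: "((\<lambda>x. 2 * (x $ 3)\<^sup>2 * (x \<bullet> v) / (norm x) ^ 4) has_derivative
      (\<lambda>w. (4 * x $ 3 * w $ 3 * (x \<bullet> v) + 2 * (x $ 3)\<^sup>2 * (w \<bullet> v)) / (norm x) ^ 4
               - 2 * (x $ 3)\<^sup>2 * (x \<bullet> v) * (4 * (norm x)\<^sup>2 * (x \<bullet> w)) / (norm x) ^ 8)) (at x)"
    by (simp add: power_mult[symmetric])
  note 3 = has_derivative_quotient[OF 0 norm_has_derivative[OF x] n0(3)]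
  show ?thesis
    unfolding kerr_level'_def kerr_rho2'_def
    by (rule has_derivative_eq_rhs[OF has_derivative_diff[OF has_derivative_add[OF
          has_derivative_mult_right[OF 0] has_derivative_mult_right[OF has_derivative_diff[OF 1 2]]]
          has_derivative_mult_right[OF 3]]])
       (simp add: kerr_level''_def fun_eq_iff)
qed

text \<open>The gradient of the function \<open>kerr_level\<close> with respect to the Kerr metric: its differential is a
  combination of \<open>x \<bullet> dx\<close> and \<open>dx\<^sub>3\<close>, so that it lies in the span of the position vector and the
  axis.\<close>

definition kerr_grad :: "real \<Rightarrow> real \<Rightarrow> real^3 \<Rightarrow> real^3" where
  "kerr_grad m a x =
     (let l = 2 * a\<^sup>2 * x $ 3 / (norm x)\<^sup>2 / kerr_C a x;
          k = (2 - 2 * m / norm x - 2 * a\<^sup>2 * (x $ 3)\<^sup>2 / (norm x) ^ 4 - kerr_E m a x * l * x $ 3)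
              / kerr_B m a x
      in k *\<^sub>R x + l *\<^sub>R axis 3 1)"

lemma inner_axis3: "x \<bullet> axis 3 1 = x $ 3" "axis 3 1 \<bullet> x = x $ 3" for x :: "real^3"
  by (simp_all add: inner_axis inner_commute[of "axis 3 1"])

lemma kerr_grad:
  assumes x: "x \<noteq> 0" and B: "kerr_B m a x \<noteq> 0"
  shows "kerr_level' m a x w = kerr_E m a x * (x \<bullet> kerr_grad m a x) * (x \<bullet> w)
           + kerr_C a x * (kerr_grad m a x \<bullet> w)"
    and "rot x (kerr_grad m a x) = 0"
proof -
  define l where "l = 2 * a\<^sup>2 * x $ 3 / (norm x)\<^sup>2 / kerr_C a x"
  define K where "K = 2 - 2 * m / norm x - 2 * a\<^sup>2 * (x $ 3)\<^sup>2 / (norm x) ^ 4"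
  define k where "k = (K - kerr_E m a x * l * x $ 3) / kerr_B m a x"
  have n: "kerr_grad m a x = k *\<^sub>R x + l *\<^sub>R axis 3 1"
    by (simp add: kerr_grad_def Let_def l_def k_def K_def)
  show "rot x (kerr_grad m a x) = 0"
    by (simp add: n rot_add rot_scale rot_self) (simp add: rot_def axis_def)
  have C: "kerr_C a x \<noteq> 0" using x kerr_rho2_pos[OF x, of a] by (simp add: kerr_C_def)
  have "kerr_level' m a x w = K * (x \<bullet> w) + (kerr_C a x * l) * w $ 3"
    using C by (simp add: kerr_level'_def kerr_rho2'_def K_def l_def algebra_simps)
  also have "K = k * kerr_B m a x + kerr_E m a x * l * x $ 3"
    using B by (simp add: k_def)
  also have "kerr_B m a x = kerr_E m a x * (norm x)\<^sup>2 + kerr_C a x"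
    using x by (simp add: kerr_B_decomp)
  finally show "kerr_level' m a x w = kerr_E m a x * (x \<bullet> kerr_grad m a x) * (x \<bullet> w)
           + kerr_C a x * (kerr_grad m a x \<bullet> w)"
    by (simp add: n inner_add_left inner_add_right inner_axis3 power2_norm_eq_inner algebra_simps)
qed

text \<open>The Hessian of \<open>kerr_level\<close> on the vector \<open>v\<close> (see \<open>kerr_hessian_level\<close>), as an explicit function of
  all arguments.\<close>

definition kerr_level_hess :: "real \<Rightarrow> real \<Rightarrow> real^3 \<Rightarrow> (real^3) \<times> real \<Rightarrow> real" where
  "kerr_level_hess m a x v = kerr_level'' m a x (fst v) (fst v)
     - kerr_metric' m a x v (kerr_grad m a x, 0) (fst v)
     + kerr_metric' m a x v v (kerr_grad m a x) / 2"

lemma kerr_level_tendsto: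
  assumes [tendsto_intros]: "(a \<longlongrightarrow> a0) F" "(x \<longlongrightarrow> x0) F" "(u \<longlongrightarrow> u0) F" "(w \<longlongrightarrow> w0) F" and x0: "x0 \<noteq> 0"
  shows "((\<lambda>i. kerr_level m (a i) \<epsilon> (x i)) \<longlongrightarrow> kerr_level m a0 \<epsilon> x0) F"
    and "((\<lambda>i. kerr_level' m (a i) (x i) (u i)) \<longlongrightarrow> kerr_level' m a0 x0 u0) F"
    and "((\<lambda>i. kerr_level'' m (a i) (x i) (u i) (w i)) \<longlongrightarrow> kerr_level'' m a0 x0 u0 w0) F"
proof -
  have nz: "norm x0 \<noteq> 0" "(norm x0)\<^sup>2 \<noteq> 0" "(norm x0) ^ 4 \<noteq> 0" "(norm x0) ^ 8 \<noteq> 0" using x0 by simp_all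
  show "((\<lambda>i. kerr_level m (a i) \<epsilon> (x i)) \<longlongrightarrow> kerr_level m a0 \<epsilon> x0) F"
    unfolding kerr_level_def kerr_rho2_def by (intro tendsto_intros nz)
  show "((\<lambda>i. kerr_level' m (a i) (x i) (u i)) \<longlongrightarrow> kerr_level' m a0 x0 u0) F"
    unfolding kerr_level'_def kerr_rho2'_def by (intro tendsto_intros nz)
  show "((\<lambda>i. kerr_level'' m (a i) (x i) (u i) (w i)) \<longlongrightarrow> kerr_level'' m a0 x0 u0 w0) F"
    unfolding kerr_level''_def by (intro tendsto_intros nz)
qed

lemma kerr_metric_tendsto:
  assumes a [tendsto_intros]: "(a \<longlongrightarrow> a0) F" and x [tendsto_intros]: "(x \<longlongrightarrow> x0) F"
    and [tendsto_intros]: "(v \<longlongrightarrow> v0) F" "(w \<longlongrightarrow> w0) F" "(y \<longlongrightarrow> y0) F"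
    and x0: "x0 \<noteq> 0" and D: "kerr_Delta m a0 (norm x0) \<noteq> 0"
  shows "((\<lambda>i. kerr_grad m (a i) (x i)) \<longlongrightarrow> kerr_grad m a0 x0) F"
    and "((\<lambda>i. kerr_metric m (a i) (x i, t) (v i) (w i)) \<longlongrightarrow> kerr_metric m a0 (x0, t) v0 w0) F"
    and "((\<lambda>i. kerr_metric' m (a i) (x i) (v i) (w i) (y i)) \<longlongrightarrow> kerr_metric' m a0 x0 v0 w0 y0) F"
proof -
  have nz: "norm x0 \<noteq> 0" "(norm x0)\<^sup>2 \<noteq> 0" "(norm x0) ^ 4 \<noteq> 0"
    "kerr_rho2 a0 x0 \<noteq> 0" "(kerr_rho2 a0 x0)\<^sup>2 \<noteq> 0" "(kerr_Delta m a0 (norm x0))\<^sup>2 \<noteq> 0"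
    "kerr_B m a0 x0 \<noteq> 0" "kerr_C a0 x0 \<noteq> 0"
    using x0 D kerr_rho2_pos[OF x0, of a0] by (simp_all add: kerr_B_def kerr_C_def)
  note nz = nz D
  have rho [tendsto_intros]: "((\<lambda>i. kerr_rho2 (a i) (x i)) \<longlongrightarrow> kerr_rho2 a0 x0) F"
    unfolding kerr_rho2_def by (intro tendsto_intros nz)
  have rho' [tendsto_intros]: "((\<lambda>i. kerr_rho2' (a i) (x i) (z i)) \<longlongrightarrow> kerr_rho2' a0 x0 z0) F"
    if [tendsto_intros]: "(z \<longlongrightarrow> z0) F" for z z0
    unfolding kerr_rho2'_def by (intro tendsto_intros nz)
  have Delta [tendsto_intros]: "((\<lambda>i. kerr_Delta m (a i) (norm (x i))) \<longlongrightarrow> kerr_Delta m a0 (norm x0)) F"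
    unfolding kerr_Delta_def by (intro tendsto_intros)
  have rot [tendsto_intros]: "((\<lambda>i. rot (z i) (q i)) \<longlongrightarrow> rot z0 q0) F"
    if [tendsto_intros]: "(z \<longlongrightarrow> z0) F" "(q \<longlongrightarrow> q0) F" for z z0 q q0
    unfolding rot_def by (intro tendsto_intros)
  have eta [tendsto_intros]: "((\<lambda>i. eta (x i) (q i)) \<longlongrightarrow> eta x0 q0) F"
    if [tendsto_intros]: "(q \<longlongrightarrow> q0) F" for q q0
    unfolding eta_def by (intro tendsto_intros nz)
  have eta' [tendsto_intros]: "((\<lambda>i. eta' (x i) (q i) (z i)) \<longlongrightarrow> eta' x0 q0 z0) F"
    if [tendsto_intros]: "(q \<longlongrightarrow> q0) F" "(z \<longlongrightarrow> z0) F" for q q0 z z0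
    unfolding eta'_def by (intro tendsto_intros nz)
  have A [tendsto_intros]: "((\<lambda>i. kerr_A m (a i) (x i)) \<longlongrightarrow> kerr_A m a0 x0) F"
    unfolding kerr_A_def by (intro tendsto_intros nz)
  have B [tendsto_intros]: "((\<lambda>i. kerr_B m (a i) (x i)) \<longlongrightarrow> kerr_B m a0 x0) F"
    unfolding kerr_B_def by (intro tendsto_intros nz)
  have C [tendsto_intros]: "((\<lambda>i. kerr_C (a i) (x i)) \<longlongrightarrow> kerr_C a0 x0) F"
    unfolding kerr_C_def by (intro tendsto_intros nz)
  have E [tendsto_intros]: "((\<lambda>i. kerr_E m (a i) (x i)) \<longlongrightarrow> kerr_E m a0 x0) F"
    unfolding kerr_E_def by (intro tendsto_intros nz)
  have A' [tendsto_intros]: "((\<lambda>i. kerr_A' m (a i) (x i) (z i)) \<longlongrightarrow> kerr_A' m a0 x0 z0) F"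
    and B' [tendsto_intros]: "((\<lambda>i. kerr_B' m (a i) (x i) (z i)) \<longlongrightarrow> kerr_B' m a0 x0 z0) F"
    and C' [tendsto_intros]: "((\<lambda>i. kerr_C' (a i) (x i) (z i)) \<longlongrightarrow> kerr_C' a0 x0 z0) F"
    if [tendsto_intros]: "(z \<longlongrightarrow> z0) F" for z z0
    unfolding kerr_A'_def kerr_B'_def kerr_C'_def by (intro tendsto_intros nz)+
  have E' [tendsto_intros]: "((\<lambda>i. kerr_E' m (a i) (x i) (z i)) \<longlongrightarrow> kerr_E' m a0 x0 z0) F"
    if [tendsto_intros]: "(z \<longlongrightarrow> z0) F" for z z0
    unfolding kerr_E'_def by (intro tendsto_intros nz)
  show "((\<lambda>i. kerr_grad m (a i) (x i)) \<longlongrightarrow> kerr_grad m a0 x0) F"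
    unfolding kerr_grad_def Let_def by (intro tendsto_intros nz)
  have eq: "kerr_metric m a (x, t) v w =
     - snd v * snd w + kerr_A m a x * (snd v - a * eta x (fst v)) * (snd w - a * eta x (fst w))
     + a\<^sup>2 * eta x (fst v) * eta x (fst w) + kerr_E m a x * (x \<bullet> fst v) * (x \<bullet> fst w)
     + kerr_C a x * (fst v \<bullet> fst w)" for a x v w
    by (cases v; cases w) (simp add: kerr_metric_eq)
  show "((\<lambda>i. kerr_metric m (a i) (x i, t) (v i) (w i)) \<longlongrightarrow> kerr_metric m a0 (x0, t) v0 w0) F"
    unfolding eq by (intro tendsto_intros)
  show "((\<lambda>i. kerr_metric' m (a i) (x i) (v i) (w i) (y i)) \<longlongrightarrow> kerr_metric' m a0 x0 v0 w0 y0) F"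
    unfolding kerr_metric'_def case_prod_unfold by (intro tendsto_intros)
qed

lemma kerr_level_hess_tendsto:
  assumes "(a \<longlongrightarrow> a0) F" "(x \<longlongrightarrow> x0) F" "(v \<longlongrightarrow> v0) F"
    and "x0 \<noteq> 0" "kerr_Delta m a0 (norm x0) \<noteq> 0"
  shows "((\<lambda>i. kerr_level_hess m (a i) (x i) (v i)) \<longlongrightarrow> kerr_level_hess m a0 x0 v0) F"
proof -
  note grad = kerr_metric_tendsto(1)[OF assms(1-3) assms(3) assms(2,4,5)]
  show ?thesis
    unfolding kerr_level_hess_def
    by (rule tendsto_add[OF tendsto_diff[OF
          kerr_level_tendsto(3)[OF assms(1,2) tendsto_fst[OF assms(3)] tendsto_fst[OF assms(3)] assms(4)]
          kerr_metric_tendsto(3)[OF assms(1-3) tendsto_Pair[OF grad tendsto_const]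
            tendsto_fst[OF assms(3)] assms(4,5)]]
          tendsto_divide[OF kerr_metric_tendsto(3)[OF assms(1-3) assms(3) grad assms(4,5)]
            tendsto_const]]) simp
qed

lemma kerr_level_C2:
  assumes S: "open S" "0 \<notin> S"
  shows "C2_on S (kerr_level m a \<epsilon>)"
proof (rule C2_onI[OF S(1)])
  fix x v assume "x \<in> S"
  then have "x \<noteq> 0" using S by auto
  then show "(kerr_level m a \<epsilon> has_derivative kerr_level' m a x) (at x)"
    "((\<lambda>x. kerr_level' m a x v) has_derivative kerr_level'' m a x v) (at x)"
    by (rule kerr_level_has_derivative kerr_level_has_derivative2)+
next
  show "continuous_on S (\<lambda>x. kerr_level'' m a x v w)" for v w
    unfolding continuous_on_def
    using S by (intro ballI kerr_level_tendsto(3) tendsto_intros) auto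
qed

lemma kerr_hessian_level:
  assumes "m > 0" "a\<^sup>2 < m\<^sup>2" "x \<in> kerr_slice m a" and S: "open S" "0 \<notin> S" "x \<in> S"
  shows "hessian (kerr_metric m a) (\<lambda>q. kerr_level m a \<epsilon> (fst q)) (x, t) v v = kerr_level_hess m a x v"
proof -
  note x = kerr_slice_pos(2)[OF assms(1-3)]
  have B: "kerr_B m a x \<noteq> 0" using kerr_B_pos[OF assms(1-3)] by simp
  have d1: "dir_deriv (kerr_level m a \<epsilon>) y w = kerr_level' m a y w" if "y \<noteq> 0" for y w
    using kerr_level_has_derivative[OF that] by (rule dir_deriv_eq)
  have "dir_deriv (\<lambda>y. dir_deriv (kerr_level m a \<epsilon>) y (fst v)) x (fst v)
      = dir_deriv (\<lambda>y. kerr_level' m a y (fst v)) x (fst v)"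
    using S by (intro dir_deriv_cong_open[of S]) (auto intro!: d1)
  also have "\<dots> = kerr_level'' m a x (fst v) (fst v)"
    using kerr_level_has_derivative2[OF x] by (rule dir_deriv_eq)
  finally have d2: "dir_deriv (\<lambda>y. dir_deriv (kerr_level m a \<epsilon>) y (fst v)) x (fst v)
      = kerr_level'' m a x (fst v) (fst v)" .
  have grad: "dir_deriv (kerr_level m a \<epsilon>) x w = kerr_E m a x * (x \<bullet> kerr_grad m a x) * (x \<bullet> w)
           + kerr_C a x * (kerr_grad m a x \<bullet> w)" for w
    unfolding d1[OF x] by (rule kerr_grad(1)[OF x B])
  show ?thesis
    unfolding kerr_hessian[OF assms(1-3) S(1,3) kerr_level_C2[OF S(1,2)] grad kerr_grad(2)[OF x B]]
      d2 kerr_level_hess_def ..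
qed

lemma kerr_level_nonpos_bound:
  assumes "m > 0" "\<epsilon> < 3 * m\<^sup>2" "kerr_level m a \<epsilon> x \<le> 0"
  shows "norm x < 3 * m"
proof -
  have "kerr_rho2 a x \<ge> (norm x)\<^sup>2" by (simp add: kerr_rho2_def)
  then have "(norm x - 3 * m) * (norm x + m) < 0"
    using assms by (simp add: kerr_level_def power2_eq_square algebra_simps)
  moreover have "norm x + m > 0" using assms(1) by (simp add: add_nonneg_pos)
  ultimately show ?thesis by (simp add: mult_less_0_iff)
qed

text \<open>In the Schwarzschild case the Hessian on tangent lightlike vectors is, up to a positive factor,
  \<open>(1 - 3m/r) dt\<^sup>2\<close>.\<close>

lemma kerr_level_hess_schwarzschild:
  assumes m: "m > 0" "\<epsilon> > 0" "\<epsilon> < 3 * m\<^sup>2" and r: "norm x > m"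
    and f: "kerr_level m 0 \<epsilon> x = 0" and tan: "kerr_level' m 0 x (fst v) = 0"
    and null: "kerr_metric m 0 (x, t) v v = 0" and nz: "v \<noteq> 0"
  shows "kerr_level_hess m 0 x v < 0"
proof -
  define r where "r = norm x"
  obtain u \<tau> where v: "v = (u, \<tau>)" by fastforce
  have r0: "r > m" "r > 0" and x: "x \<noteq> 0" using m r by (auto simp: r_def)
  have f': "r\<^sup>2 - 2 * m * r = \<epsilon>" using f by (simp add: kerr_level_def kerr_rho2_def r_def)
  have r3: "r < 3 * m" using kerr_level_nonpos_bound[of m \<epsilon> 0 x] f m by (simp add: r_def)
  define B where "B = kerr_B m 0 x"
  define K where "K = 2 - 2 * m / r"
  have B: "B > 0" using f' m x by (simp add: B_def kerr_B_def kerr_rho2_def kerr_Delta_def r_def)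
  have K: "K > 0" using r0 m by (simp add: K_def divide_less_eq)
  have "K * (x \<bullet> u) = 0"
    using tan x by (simp add: kerr_level'_def kerr_rho2'_def v K_def r_def algebra_simps)
  then have xu: "x \<bullet> u = 0" using K by simp
  have A: "kerr_A m 0 x = 2 * m / r" and A': "kerr_A' m 0 x x = - 2 * m / r"
    and C: "kerr_C 0 x = 1"
    using x by (simp_all add: kerr_A_def kerr_A'_radial kerr_C_def kerr_rho2_def r_def power2_eq_square)
  have nu: "(norm u)\<^sup>2 = (1 - 2 * m / r) * \<tau>\<^sup>2"
    using null unfolding power2_norm_eq_inner
    by (simp add: v kerr_metric_eq xu A C power2_eq_square algebra_simps)
  have \<tau>: "\<tau> \<noteq> 0"
    using nu nz by (auto simp: v zero_prod_def)
  have "kerr_grad m 0 x = (K / B) *\<^sub>R x"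
    by (simp add: kerr_grad_def K_def B_def r_def)
  then have "kerr_level_hess m 0 x v = kerr_level'' m 0 x u u
      + (- (K / B) * (B - 1) * (norm u)\<^sup>2 + (K / B) / 2 * (- 2 * m / r) * \<tau>\<^sup>2)"
    using kerr_metric'_radial[OF x xu, of m 0 \<tau> "K / B"]
    by (simp add: kerr_level_hess_def v B_def[symmetric] A')
  also have "kerr_level'' m 0 x u u = K * (norm u)\<^sup>2"
    using x by (simp add: kerr_level''_def K_def xu power2_norm_eq_inner r_def algebra_simps)
  also have "K * (norm u)\<^sup>2 + (- (K / B) * (B - 1) * (norm u)\<^sup>2 + (K / B) / 2 * (- 2 * m / r) * \<tau>\<^sup>2)
      = K / B * ((norm u)\<^sup>2 - m / r * \<tau>\<^sup>2)"
    using B r0 by (simp add: field_simps)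
  also have "(norm u)\<^sup>2 - m / r * \<tau>\<^sup>2 = (1 - 3 * m / r) * \<tau>\<^sup>2"
    by (simp add: nu algebra_simps)
  finally have "kerr_level_hess m 0 x v = K / B * ((1 - 3 * m / r) * \<tau>\<^sup>2)" .
  moreover have "(1 - 3 * m / r) * \<tau>\<^sup>2 < 0"
    using r3 r0 \<tau> by (intro mult_neg_pos) auto
  ultimately show ?thesis using K B by (metis mult_pos_neg divide_pos_pos)
qed

lemma kerr_metric'_scale:
  "kerr_metric' m a x (c *\<^sub>R v) (d *\<^sub>R w) (e *\<^sub>R y) = c * d * e * kerr_metric' m a x v w y"
  by (cases v; cases w)
     (simp add: kerr_metric'_def eta_scale eta'_scale kerr_A'_scale kerr_C'_scale kerr_E'_scale algebra_simps)

lemma kerr_level_hess_scale: "kerr_level_hess m a x (c *\<^sub>R v) = c\<^sup>2 * kerr_level_hess m a x v"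
proof -
  have "kerr_level'' m a x (c *\<^sub>R u) (c *\<^sub>R u) = c\<^sup>2 * kerr_level'' m a x u u" for u
    by (simp add: kerr_level''_def power2_eq_square add_divide_distrib diff_divide_distrib algebra_simps)
  then show ?thesis
    using kerr_metric'_scale[of m a x c v 1 "(kerr_grad m a x, 0)" c "fst v"]
      kerr_metric'_scale[of m a x c v c v 1 "kerr_grad m a x"]
    by (simp add: kerr_level_hess_def power2_eq_square algebra_simps)
qed

text \<open>If no \<open>a0\<close> existed, there would be a sequence of rotation parameters tending to \<open>0\<close> with normalised
  lightlike tangent vectors on which the Hessian is nonnegative; a limit point contradicts the
  Schwarzschild case.\<close>

lemma kerr_level_hess_neg:
  assumes m: "m > 0" "\<epsilon> > 0" "\<epsilon> < 3 * m\<^sup>2"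
  shows "\<exists>a0>0. \<forall>a x v. \<bar>a\<bar> < a0 \<and> norm x > m \<and> kerr_level m a \<epsilon> x = 0 \<and> kerr_level' m a x (fst v) = 0
    \<and> kerr_metric m a (x, t) v v = 0 \<and> v \<noteq> 0 \<longrightarrow> kerr_level_hess m a x v < 0"
proof (rule ccontr)
  define P where "P a x v \<longleftrightarrow> norm x > m \<and> kerr_level m a \<epsilon> x = 0 \<and> kerr_level' m a x (fst v) = 0
    \<and> kerr_metric m a (x, t) v v = 0 \<and> kerr_level_hess m a x v \<ge> 0 \<and> norm v = 1" for a x v
  assume neg: "\<not> ?thesis"
  have "\<exists>a x v. \<bar>a\<bar> < 1 / real (Suc n) \<and> P a x v" for n
  proof -
    have pos: "1 / real (Suc n) > 0" by simp
    obtain a x v where a: "\<bar>a\<bar> < 1 / real (Suc n)" and v: "norm x > m" "kerr_level m a \<epsilon> x = 0"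
      "kerr_level' m a x (fst v) = 0" "kerr_metric m a (x, t) v v = 0" "v \<noteq> 0" "\<not> kerr_level_hess m a x v < 0"
      using neg pos by blast
    define c where "c = 1 / norm v"
    have "kerr_level' m a x (c *\<^sub>R fst v) = c * kerr_level' m a x (fst v)"
      by (simp add: kerr_level'_def kerr_rho2'_def algebra_simps)
    then have "P a x (c *\<^sub>R v)"
      using v by (simp add: P_def kerr_level_hess_scale bilinear_lmul[OF kerr_metric_bilinear]
          bilinear_rmul[OF kerr_metric_bilinear]) (simp add: c_def)
    with a show ?thesis by blast
  qed
  then obtain a x v where a: "\<And>n. \<bar>a n\<bar> < 1 / real (Suc n)" and P: "\<And>n. P (a n) (x n) (v n)"
    by metis
  have bound: "norm (x n) \<le> 3 * m" for n
    using kerr_level_nonpos_bound[of m \<epsilon> "a n" "x n"] P[of n] m by (simp add: P_def)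
  have "compact (cball (0::real^3) (3 * m) \<times> sphere (0::(real^3)\<times>real) 1)" by (intro compact_Times) auto
  moreover have "\<forall>n. (x n, v n) \<in> cball 0 (3 * m) \<times> sphere 0 1"
    using bound P by (simp add: P_def)
  ultimately obtain l \<sigma> where \<sigma>: "strict_mono (\<sigma> :: nat \<Rightarrow> nat)"
      and l: "((\<lambda>n. (x n, v n)) \<circ> \<sigma>) \<longlonglongrightarrow> l"
    unfolding compact_def by meson
  define x0 where "x0 = fst l"
  define v0 where "v0 = snd l"
  have lx: "(\<lambda>n. x (\<sigma> n)) \<longlonglongrightarrow> x0" and lv: "(\<lambda>n. v (\<sigma> n)) \<longlonglongrightarrow> v0"
    using tendsto_fst[OF l] tendsto_snd[OF l] by (simp_all add: x0_def v0_def comp_def)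
  have "a \<longlonglongrightarrow> 0"
    by (rule Lim_null_comparison[OF _ LIMSEQ_inverse_real_of_nat])
       (use a in \<open>auto simp: inverse_eq_divide intro!: always_eventually less_imp_le\<close>)
  then have la: "(\<lambda>n. a (\<sigma> n)) \<longlonglongrightarrow> 0"
    using \<sigma> LIMSEQ_subseq_LIMSEQ by (fastforce simp: comp_def)
  have P: "P (a (\<sigma> n)) (x (\<sigma> n)) (v (\<sigma> n))" for n by (rule P)
  have "norm x0 \<ge> m"
    using P by (intro LIMSEQ_le_const[OF tendsto_norm[OF lx]]) (auto simp: P_def intro: less_imp_le)
  then have x0: "x0 \<noteq> 0" using m by auto
  note lf = kerr_level_tendsto[OF la lx tendsto_fst[OF lv] tendsto_const x0]
  have zero: "y = 0" if "g \<longlonglongrightarrow> y" "\<And>n. g n = 0" for g :: "nat \<Rightarrow> real" and y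
    using that(1) LIMSEQ_const_iff[of 0 y] by (simp add: that(2) fun_eq_iff[THEN iffD2, of g "\<lambda>_. 0"])
  have f: "kerr_level m 0 \<epsilon> x0 = 0"
    using P by (intro zero[OF lf(1)]) (simp add: P_def)
  have tan: "kerr_level' m 0 x0 (fst v0) = 0"
    using P by (intro zero[OF lf(2)]) (simp add: P_def)
  have f': "(norm x0)\<^sup>2 - 2 * m * norm x0 = \<epsilon>"
    using f by (simp add: kerr_level_def kerr_rho2_def)
  then have D: "kerr_Delta m 0 (norm x0) \<noteq> 0" using m by (simp add: kerr_Delta_def)
  have "norm x0 \<noteq> m" using f' m by (auto simp: power2_eq_square)
  with \<open>norm x0 \<ge> m\<close> have r: "norm x0 > m" by simp
  have null: "kerr_metric m 0 (x0, t) v0 v0 = 0"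
    using P by (intro zero[OF kerr_metric_tendsto(2)[OF la lx lv lv lx x0 D]]) (simp add: P_def)
  have "norm v0 = 1"
    using P by (intro LIMSEQ_unique[OF tendsto_norm[OF lv]]) (simp add: P_def)
  then have "v0 \<noteq> 0" by auto
  from kerr_level_hess_schwarzschild[OF m r f tan null this] have "kerr_level_hess m 0 x0 v0 < 0" .
  moreover have "kerr_level_hess m 0 x0 v0 \<ge> 0"
    using P by (intro LIMSEQ_le_const[OF kerr_level_hess_tendsto[OF la lx lv x0 D]]) (auto simp: P_def)
  ultimately show False by simp
qed

section \<open>The domain\<close>

lemma cos_polar_scale: "c > 0 \<Longrightarrow> cos_polar (c *\<^sub>R x) = cos_polar x"
  by (simp add: cos_polar_def)

lemma kerr_level_pos_iff:
  assumes "a\<^sup>2 < m\<^sup>2" "\<epsilon> \<ge> 0"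
  shows "m + sqrt (m\<^sup>2 + \<epsilon> - a\<^sup>2 * (cos_polar x)\<^sup>2) < norm x \<longleftrightarrow> m < norm x \<and> kerr_level m a \<epsilon> x > 0"
proof -
  define X where "X = m\<^sup>2 + \<epsilon> - a\<^sup>2 * (cos_polar x)\<^sup>2"
  have "a\<^sup>2 * (cos_polar x)\<^sup>2 \<le> a\<^sup>2" using cos_polar_le1 by (simp add: mult_left_le)
  then have X: "X \<ge> 0" using assms by (simp add: X_def)
  have "kerr_level m a \<epsilon> x = (norm x - m)\<^sup>2 - X"
    by (simp add: kerr_level_def kerr_rho2_def X_def cos_polar_def power_divide power2_diff)
  moreover have "sqrt X < norm x - m \<longleftrightarrow> 0 < norm x - m \<and> X < (norm x - m)\<^sup>2"
  proof
    assume l: "sqrt X < norm x - m"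
    then have "(sqrt X)\<^sup>2 < (norm x - m)\<^sup>2" using X by (intro power_strict_mono) auto
    with l X show "0 < norm x - m \<and> X < (norm x - m)\<^sup>2"
      by (metis le_less_trans real_sqrt_ge_zero real_sqrt_pow2)
  next
    assume "0 < norm x - m \<and> X < (norm x - m)\<^sup>2"
    then show "sqrt X < norm x - m" by (intro real_less_lsqrt) auto
  qed
  ultimately show ?thesis unfolding X_def[symmetric] by auto
qed

lemma kerr_slice_iff:
  assumes "a\<^sup>2 < m\<^sup>2"
  shows "x \<in> kerr_slice m a \<longleftrightarrow> m < norm x \<and> kerr_level m a 0 x > 0"
  using kerr_level_pos_iff[OF assms, of 0 x] by (simp add: kerr_slice_def)

lemma kerr_domain_iff:
  assumes "a\<^sup>2 < m\<^sup>2" "\<epsilon> > 0"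
  shows "x \<in> kerr_domain m a \<epsilon> r0 \<longleftrightarrow> m < norm x \<and> kerr_level m a \<epsilon> x > 0 \<and> ereal (norm x) < r0"
  using kerr_level_pos_iff[OF assms(1), of \<epsilon> x] assms(2) by (auto simp: kerr_domain_def)

lemma open_kerr_slice:
  assumes "m > 0" "a\<^sup>2 < m\<^sup>2"
  shows "open (kerr_slice m a)"
proof -
  let ?U = "{x::real^3. m < norm x}"
  have U: "open ?U" by (intro open_Collect_less continuous_intros)
  have "C2_on ?U (kerr_level m a 0)" using U assms(1) by (intro kerr_level_C2) auto
  then have "continuous_on ?U (kerr_level m a 0)" by (intro C1_on_continuous C2_on_C1)
  with U have "open (?U \<inter> kerr_level m a 0 -` {0<..})"
    by (simp add: continuous_on_open_vimage Int_commute)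
  moreover have "?U \<inter> kerr_level m a 0 -` {0<..} = kerr_slice m a"
    using kerr_slice_iff[OF assms(2)] by auto
  ultimately show ?thesis by simp
qed

text \<open>The angle, and with it the inner boundary radius, is constant along rays. Hence each point of
  the domain is joined to the sphere within the domain by a radial segment.\<close>

lemma connected_kerr_domain:
  assumes sub: "sphere 0 R \<subseteq> kerr_domain m a \<epsilon> r0" and R: "R > 0" and m: "m > 0" "a\<^sup>2 < m\<^sup>2" "\<epsilon> > 0"
  shows "connected (kerr_domain m a \<epsilon> r0)"
proof -
  let ?D = "kerr_domain m a \<epsilon> r0" and ?S = "sphere (0::real^3) R"
  define p where "p x = (R / norm x) *\<^sub>R x" for x :: "real^3"
  have seg: "closed_segment x (p x) \<subseteq> ?D" and pS: "p x \<in> ?S" if x: "x \<in> ?D" for x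
  proof -
    have n0: "norm x > 0" using x m by (auto simp: kerr_domain_iff[OF m(2,3)] intro: less_trans)
    then show pS: "p x \<in> ?S" using R by (simp add: p_def)
    let ?b = "m + sqrt (m\<^sup>2 + \<epsilon> - a\<^sup>2 * (cos_polar x)\<^sup>2)"
    have "cos_polar (p x) = cos_polar x" using n0 R by (simp add: p_def cos_polar_scale)
    moreover have "norm (p x) = R" using pS by simp
    moreover have "p x \<in> ?D" using sub pS by auto
    ultimately have b: "?b < R" "ereal R < r0" "?b < norm x" "ereal (norm x) < r0"
      using x by (auto simp: kerr_domain_def)
    show "closed_segment x (p x) \<subseteq> ?D"
    proof
      fix y assume "y \<in> closed_segment x (p x)"
      then obtain s where s: "0 \<le> s" "s \<le> 1" and y: "y = (1 - s) *\<^sub>R x + s *\<^sub>R p x"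
        by (auto simp: in_segment)
      define c where "c = (1 - s) + s * (R / norm x)"
      have yc: "y = c *\<^sub>R x" by (simp add: y c_def p_def algebra_simps)
      have "c > 0"
      proof (cases "s = 0")
        case False
        then show ?thesis using s n0 R unfolding c_def by (intro add_nonneg_pos) auto
      qed (simp add: c_def)
      then have cos: "cos_polar y = cos_polar x" by (simp add: yc cos_polar_scale)
      have ny: "norm y = (1 - s) * norm x + s * R"
      proof -
        have "norm y = c * norm x" using \<open>c > 0\<close> by (simp add: yc)
        also have "\<dots> = (1 - s) * norm x + s * R" using n0 by (simp add: c_def distrib_right)
        finally show ?thesis .
      qed
      have "?b < norm y"
        unfolding ny using convex_bound_lt[of "- norm x" "- ?b" "- R" "1 - s" s] b s
        by (simp add: algebra_simps)
      moreover have "norm y \<le> max (norm x) R"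
        unfolding ny using s by (intro convex_bound_le) auto
      then have "ereal (norm y) < r0"
        using b by (metis ereal_less_eq(3) le_less_trans max_def)
      ultimately show "y \<in> ?D" by (simp add: kerr_domain_def cos)
    qed
  qed
  have S: "connected ?S" by (rule connected_sphere) simp
  let ?F = "(\<lambda>x. ?S \<union> closed_segment x (p x)) ` ?D"
  have "connected (?S \<union> closed_segment x (p x))" if "x \<in> ?D" for x
  proof (rule connected_Un[OF S connected_segment])
    have "p x \<in> ?S \<inter> closed_segment x (p x)" using pS[OF that] by simp
    then show "?S \<inter> closed_segment x (p x) \<noteq> {}" by blast
  qed
  then have "\<forall>T\<in>?F. connected T" by blast
  moreover have "p (axis 3 1) \<in> \<Inter>?F" using R by (simp add: p_def)
  ultimately have "connected (\<Union>?F)" by (intro connected_Union) auto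
  moreover have "\<Union>?F = ?D"
    using seg sub by auto
  ultimately show ?thesis by simp
qed

lemma kerr_metric_stationary: "kerr_metric m a (x, t) v w = kerr_metric m a (x, s) v w"
  by (cases v; cases w) (simp add: kerr_metric_eq)

text \<open>The outer boundary is described by a function \<open>h\<close>, so that the cases of finite and of infinite
  outer radius can be treated together.\<close>

lemma kerr_domain_strongly_light_convex:
  assumes m: "m > 0" "0 < \<epsilon>" "\<epsilon> < 3 * m\<^sup>2" "a\<^sup>2 < m\<^sup>2" and r0: "ereal (12 * m) < r0"
    and inner: "\<And>x t v. norm x > m \<Longrightarrow> kerr_level m a \<epsilon> x = 0 \<Longrightarrow> kerr_level' m a x (fst v) = 0 \<Longrightarrow>
      kerr_metric m a (x, t) v v = 0 \<Longrightarrow> v \<noteq> 0 \<Longrightarrow> kerr_level_hess m a x v < 0"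
    and h: "C2_on (kerr_slice m a) h" "\<And>x. h x > 0 \<longleftrightarrow> ereal (norm x) < r0"
    and h0: "\<And>x. h x = 0 \<Longrightarrow> dir_deriv h x x \<noteq> 0"
    and outer: "\<And>x t v. x \<in> kerr_slice m a \<Longrightarrow> h x = 0 \<Longrightarrow> dir_deriv h x (fst v) = 0 \<Longrightarrow>
      kerr_metric m a (x, t) v v = 0 \<Longrightarrow> v \<noteq> 0 \<Longrightarrow>
      hessian (kerr_metric m a) (\<lambda>q. h (fst q)) (x, t) v v < 0"
  shows "strongly_light_convex_boundary (kerr_slice m a) (kerr_metric m a) (kerr_domain m a \<epsilon> r0)"
proof -
  let ?S = "kerr_slice m a" and ?D = "kerr_domain m a \<epsilon> r0" and ?f = "kerr_level m a \<epsilon>"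
  let ?\<phi> = "\<lambda>x. ?f x * h x"
  have S: "open ?S" using m by (intro open_kerr_slice)
  have S0: "0 \<notin> ?S" and Sm: "\<And>x. x \<in> ?S \<Longrightarrow> norm x > m" "\<And>x. x \<in> ?S \<Longrightarrow> x \<noteq> 0"
    using kerr_slice_pos[OF m(1,4)] by auto
  have f: "C2_on ?S ?f" using S S0 by (rule kerr_level_C2)
  have \<phi>: "C2_on ?S ?\<phi>" using S f h(1) by (rule C2_on_mult)
  have h_pos: "h x > 0" if "?f x \<le> 0" for x
  proof -
    have "norm x < 12 * m" using kerr_level_nonpos_bound[OF m(1,3) that] m(1) by simp
    then show ?thesis using r0 unfolding h(2) by (metis less_ereal.simps(1) less_trans)
  qed
  have "kerr_level m a 0 x > 0" if "?f x > 0" for x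
    using that m(2) by (simp add: kerr_level_def)
  moreover have "?f x > 0 \<and> h x > 0 \<longleftrightarrow> ?\<phi> x > 0" for x
    using h_pos[of x] by (auto simp: zero_less_mult_iff)
  ultimately have D: "?D = {x \<in> ?S. ?\<phi> x > 0}"
    unfolding set_eq_iff mem_Collect_eq kerr_domain_iff[OF m(4,2)] kerr_slice_iff[OF m(4)]
      h(2)[symmetric] by blast
  have df: "dir_deriv ?f x w = kerr_level' m a x w" if "x \<in> ?S" for x w
    using kerr_level_has_derivative[OF Sm(2)[OF that]] by (rule dir_deriv_eq)
  have d\<phi>: "dir_deriv ?\<phi> x w = ?f x * dir_deriv h x w + kerr_level' m a x w * h x" if "x \<in> ?S" for x w
    using f h(1) that by (subst dir_deriv_mult) (auto simp: C2_on_def df)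
  have reg: "\<exists>v. dir_deriv ?\<phi> x v \<noteq> 0" if x: "x \<in> ?S" "?\<phi> x = 0" for x
  \<comment> \<open>The radial direction is transversal to both boundary components.\<close>
  proof (intro exI[of _ x])
    have "kerr_level' m a x x = 2 * norm x * (norm x - m)"
      using Sm(2)[OF x(1)] by (simp add: kerr_level'_def kerr_rho2'_radial
          power2_norm_eq_inner[symmetric] power2_eq_square algebra_simps)
    then have "kerr_level' m a x x \<noteq> 0" using Sm[OF x(1)] m(1) by simp
    then show "dir_deriv ?\<phi> x x \<noteq> 0"
      using x h_pos[of x] h0[of x] by (auto simp: d\<phi>)
  qed
  note frontier = regular_zero_frontier[OF S \<phi> reg, folded D]
  have sphere: "sphere 0 (12 * m) \<subseteq> ?D"
  proof
    fix x :: "real^3" assume "x \<in> sphere 0 (12 * m)"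
    then have "norm x = 12 * m" by simp
    then show "x \<in> ?D"
      using kerr_level_nonpos_bound[OF m(1,3), of a x] m(1) r0
      unfolding kerr_domain_iff[OF m(4,2)] by fastforce
  qed
  have conn: "connected ?D"
    using m by (intro connected_kerr_domain[OF sphere]) auto
  have "(12 * m) *\<^sub>R axis 3 1 \<in> sphere (0::real^3) (12 * m)" using m(1) by simp
  with sphere have ne: "?D \<noteq> {}" by blast
  have hess: "hessian (kerr_metric m a) (\<lambda>p. ?\<phi> (fst p)) (x, t) v v < 0"
    if x: "x \<in> ?S \<inter> frontier ?D" and v: "v \<noteq> 0" "kerr_metric m a (x, t) v v = 0"
      and tan: "dir_deriv (\<lambda>p. ?\<phi> (fst p)) (x, t) v = 0" for x t v
  proof -
    have xS: "x \<in> ?S" and x0: "?\<phi> x = 0" using x frontier(2) by auto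
    have "dir_deriv ?\<phi> x (fst v) = 0"
      using tan \<phi> xS dir_deriv_fst[of ?\<phi> "(x, t)" v] by (simp add: C2_on_def)
    then have tan: "?f x * dir_deriv h x (fst v) + kerr_level' m a x (fst v) * h x = 0"
      by (simp add: d\<phi>[OF xS])
    show ?thesis
    proof (cases "?f x = 0")
      case True
      then have hx: "h x > 0" using h_pos by simp
      then have t': "kerr_level' m a x (fst v) = 0" using tan True by simp
      have "hessian (kerr_metric m a) (\<lambda>p. ?\<phi> (fst p)) (x, t) v v = h x * kerr_level_hess m a x v"
        using hessian_mult_zero[of ?S "(x, t)" ?f h v] S xS f h(1) True t'
        by (simp add: df kerr_hessian_level[OF m(1,4) xS S S0 xS])
      then show ?thesis
        using inner[OF Sm(1)[OF xS] True t' v(2,1)] hx by (simp add: mult_pos_neg)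
    next
      case False
      then have hx: "h x = 0" using x0 by simp
      then have fx: "?f x > 0" using h_pos[of x] by force
      then have t': "dir_deriv h x (fst v) = 0" using tan hx by simp
      have "hessian (kerr_metric m a) (\<lambda>p. ?\<phi> (fst p)) (x, t) v v
          = ?f x * hessian (kerr_metric m a) (\<lambda>p. h (fst p)) (x, t) v v"
        using hessian_mult_zero[of ?S "(x, t)" h ?f v] S xS f h(1) hx t'
        by (simp add: mult.commute)
      then show ?thesis
        using outer[OF xS hx t' v(2,1)] fx by (simp add: mult_pos_neg)
    qed
  qed
  show ?thesis
    unfolding strongly_light_convex_boundary_def
  proof (intro conjI exI[of _ ?\<phi>] ballI allI impI)
    show "open ?D" by (rule frontier(1))
    show "{x \<in> ?S. ?\<phi> x = 0} = ?S \<inter> frontier ?D" by (rule frontier(2))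
    show "?D \<subseteq> ?S" "\<And>x. x \<in> ?D \<Longrightarrow> 0 < ?\<phi> x" by (auto simp: D)
    show "\<exists>v. dir_deriv ?\<phi> x v \<noteq> 0" if "x \<in> ?S \<inter> frontier ?D" for x
      using that frontier(2) reg by blast
  qed (use conn ne \<phi> hess in auto)
qed

theorem corollary4p12:
  fixes m \<epsilon> :: real
  assumes "m > 0" and "0 < \<epsilon>" and "\<epsilon> < m" and "\<epsilon> < 3 * m\<^sup>2"
  shows "\<exists>a0>0. \<exists>R::real. \<forall>(a::real) (r0::ereal).
           a\<^sup>2 < m\<^sup>2 \<and> \<bar>a\<bar> < a0 \<and> 0 < r0 \<and> ereal R < r0 \<longrightarrow>
           strongly_light_convex_boundary (kerr_slice m a) (kerr_metric m a)
             (kerr_domain m a \<epsilon> r0)"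
proof -
  obtain a0 where a0: "a0 > 0" and inner: "\<And>a x v. \<bar>a\<bar> < a0 \<Longrightarrow> norm x > m \<Longrightarrow> kerr_level m a \<epsilon> x = 0 \<Longrightarrow>
      kerr_level' m a x (fst v) = 0 \<Longrightarrow> kerr_metric m a (x, 0) v v = 0 \<Longrightarrow> v \<noteq> 0 \<Longrightarrow> kerr_level_hess m a x v < 0"
    using kerr_level_hess_neg[OF assms(1,2,4), of 0] by blast
  have "strongly_light_convex_boundary (kerr_slice m a) (kerr_metric m a) (kerr_domain m a \<epsilon> r0)"
    if a: "a\<^sup>2 < m\<^sup>2" "\<bar>a\<bar> < a0" and r0: "ereal (12 * m) < r0" for a and r0 :: ereal
  proof -
    have S: "open (kerr_slice m a)" using assms(1) a(1) by (rule open_kerr_slice)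
    have inner': "kerr_level_hess m a x v < 0"
      if "norm x > m" "kerr_level m a \<epsilon> x = 0" "kerr_level' m a x (fst v) = 0" "kerr_metric m a (x, t) v v = 0"
        "v \<noteq> 0" for x t v
      using inner[OF a(2) that(1-3) _ that(5)] that(4) kerr_metric_stationary by metis
    note convex = kerr_domain_strongly_light_convex[OF assms(1,2,4) a(1) r0 inner']
    show ?thesis
    proof (cases r0)
      case (real r)
      then have r: "r > 12 * m" "r > 0" using r0 assms(1) by auto
      let ?h = "\<lambda>x::real^3. r\<^sup>2 - (norm x)\<^sup>2"
      have h0: "norm x = r" if "?h x = 0" for x
        using that r(2) by (simp add: power2_eq_iff_nonneg)
      have dh: "dir_deriv ?h x w = - 2 * (x \<bullet> w)" for x w
        by (rule dir_deriv_eq[OF sphere_has_derivative])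
      show ?thesis
      proof (rule convex)
        show "C2_on (kerr_slice m a) ?h" using S by (rule sphere_C2)
        show "?h x > 0 \<longleftrightarrow> ereal (norm x) < r0" for x
          using r(2) power_mono_iff[of r "norm x" 2] by (simp add: real flip: not_le)
        show "dir_deriv ?h x x \<noteq> 0" if "?h x = 0" for x
          using h0[OF that] r(2) by (auto simp: dh)
        show "hessian (kerr_metric m a) (\<lambda>q. ?h (fst q)) (x, t) v v < 0"
          if "x \<in> kerr_slice m a" "?h x = 0" "dir_deriv ?h x (fst v) = 0"
            "kerr_metric m a (x, t) v v = 0" "v \<noteq> 0" for x t v
          using kerr_hessian_sphere_neg[OF assms(1) a(1) that(1) S that(1), of "fst v" t "snd v"]
            that h0[OF that(2)] r by (simp add: dh)
      qed
    next
      case PInf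
      show ?thesis
      proof (rule convex[where h = "\<lambda>_. 1"])
        show "C2_on (kerr_slice m a) (\<lambda>_. 1)"
          by (rule C2_onI[OF S, where f' = "\<lambda>_ _. 0" and f'' = "\<lambda>_ _ _. 0"]) simp_all
        show "(1::real) > 0 \<longleftrightarrow> ereal (norm x) < r0" for x :: "real^3"
          by (simp add: PInf)
      qed simp_all
    next
      case MInf
      then show ?thesis using r0 by simp
    qed
  qed
  with a0 show ?thesis
    by (intro exI[of _ a0] exI[of _ "12 * m"] conjI allI impI) auto
qed

end
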